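(* Let $m,n\ge 3$ be integers, and let $T_{m,n}=C_m\,\square\,C_n$ be the toroidal grid graph. Then its treewidth satisfies: \begin{itemize} \item if $|m-n|\ge 2$, then $\operatorname{tw}(T_{m,n})=2\min\{m,n\}$; \item if $|m-n|=1$, then $\operatorname{tw}(T_{m,n})$ equals either $2\min\{m,n\}-1$ or $2\min\{m,n\}$; \item if $m=n$, then $\operatorname{tw}(T_{m,n})$ equals either $2n-2$ or $2n-1$. \end{itemize} Moreover, both possible values occur in each of the last two cases: among pairs $(m,n)$ with $|m-n|=1$ there is one with $\operatorname{tw}(T_{m,n})=2\min\{m,n\}-1$ and one with $\operatorname{tw}(T_{m,n})=2\min\{m,n\}$; and there is a value of $n$ with $\operatorname{tw}(T_{n,n})=2n-2$ and a value of $n$ with $\operatorname{tw}(T_{n,n})=2n-1$.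
   Context: $C_n$ is the cycle on $n$ vertices. The Cartesian product $G_1\,\square\,G_2$ has vertex set $V(G_1)\times V(G_2)$, with $(v_1,v_2)$ adjacent to $(u_1,u_2)$ iff either $v_2=u_2$ and $v_1u_1\in E(G_1)$, or $v_1=u_1$ and $v_2u_2\in E(G_2)$. A tree decomposition of a graph $G$ is a pair $(T,\mathcal V)$ with $T$ a tree and $\mathcal V=\{V_t\}_{t\in T}$ a family of subsets $V_t\subset V(G)$ indexed by the nodes of $T$ such that: (1) $\bigcup_{t}V_t=V(G)$; (2) for every edge $uv\in E(G)$ there is a node $t$ with $u,v\in V_t$; (3) if $v\in V_{t_1}\cap V_{t_2}$ then $v\in V_{t'}$ for every node $t'$ on the path from $t_1$ to $t_2$ in $T$. Its width is $\max_t(|V_t|-1)$. The treewidth $\operatorname{tw}(G)$ is the minimum width of a tree decomposition of $G$. *)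

theory Defs
  imports "Graph_Theory.Graph_Theory"
begin

text \<open>
  Finite simple graphs are values of type \<open>'a pair_pre_digraph\<close> satisfying \<^const>\<open>pair_graph\<close>
  (finite, symmetric, loop-free); an undirected edge \<open>uv\<close> is the pair of arcs \<open>(u,v)\<close>, \<open>(v,u)\<close>.
\<close>

text \<open>For \<open>n \<ge> 3\<close> this is the cycle on \<open>n\<close> vertices; smaller \<open>n\<close> are not used.\<close>
definition cycle_graph :: "nat \<Rightarrow> nat pair_pre_digraph" where
  "cycle_graph n = \<lparr> pverts = {..<n},
     parcs = {(i, j). i < n \<and> j < n \<and> (j = Suc i mod n \<or> i = Suc j mod n)} \<rparr>"

definition cartesian_product ::
  "'a pair_pre_digraph \<Rightarrow> 'b pair_pre_digraph \<Rightarrow> ('a \<times> 'b) pair_pre_digraph" where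
  "cartesian_product G H = \<lparr> pverts = pverts G \<times> pverts H,
     parcs = {((v1, v2), (u1, u2)).
       (v2 = u2 \<and> v2 \<in> pverts H \<and> (v1, u1) \<in> parcs G) \<or>
       (v1 = u1 \<and> v1 \<in> pverts G \<and> (v2, u2) \<in> parcs H)} \<rparr>"

definition toroidal_grid :: "nat \<Rightarrow> nat \<Rightarrow> (nat \<times> nat) pair_pre_digraph" where
  "toroidal_grid m n = cartesian_product (cycle_graph m) (cycle_graph n)"

text \<open>
  The constant \<^const>\<open>tree\<close> of the digraph library counts \<open>a, b, a\<close> as a cycle, so no symmetric
  digraph with an edge satisfies it. Here a cycle is an undirected one: at least three distinct
  vertices, consecutive ones adjacent, the last adjacent to the first.
  Note that \<^const>\<open>connected\<close> includes non-emptiness.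
\<close>
definition undirected_tree :: "'a pair_pre_digraph \<Rightarrow> bool" where
  "undirected_tree T \<longleftrightarrow> pair_graph T \<and> connected T \<and>
     \<not> (\<exists>p. vpath p T \<and> length p \<ge> 3 \<and> (last p, hd p) \<in> parcs T)"

text \<open>Only the bags \<open>V t\<close> with \<open>t \<in> pverts T\<close> are relevant.\<close>
definition tree_decomposition ::
  "'a pair_pre_digraph \<Rightarrow> 't pair_pre_digraph \<Rightarrow> ('t \<Rightarrow> 'a set) \<Rightarrow> bool" where
  "tree_decomposition G T V \<longleftrightarrow> undirected_tree T \<and>
     (\<Union>t\<in>pverts T. V t) = pverts G \<and>
     (\<forall>(u, v)\<in>parcs G. \<exists>t\<in>pverts T. u \<in> V t \<and> v \<in> V t) \<and>
     (\<forall>t1\<in>pverts T. \<forall>t2\<in>pverts T. \<forall>v \<in> V t1 \<inter> V t2.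
        \<forall>p. vpath p T \<and> hd p = t1 \<and> last p = t2 \<longrightarrow> (\<forall>t'\<in>set p. v \<in> V t'))"

text \<open>Integer-valued, so that the subtraction does not truncate.\<close>
definition decomposition_width :: "'t pair_pre_digraph \<Rightarrow> ('t \<Rightarrow> 'a set) \<Rightarrow> int" where
  "decomposition_width T V = (MAX t\<in>pverts T. int (card (V t)) - 1)"

text \<open>
  Every finite tree is isomorphic to one whose nodes are natural numbers, so it suffices to
  minimise over those.
\<close>
definition treewidth :: "'a pair_pre_digraph \<Rightarrow> int" where
  "treewidth G = (LEAST w. \<exists>(T :: nat pair_pre_digraph) V.
     tree_decomposition G T V \<and> w = decomposition_width T V)"

lemma pair_graph_cycle_graph:
  assumes "n \<ge> 2"
  shows "pair_graph (cycle_graph n)"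
proof
  show "finite (parcs (cycle_graph n))"
    by (rule finite_subset[of _ "{..<n} \<times> {..<n}"]) (auto simp: cycle_graph_def)
  show "symmetric (cycle_graph n)"
    by (auto simp: symmetric_def cycle_graph_def intro!: symI)
  fix e assume "e \<in> parcs (cycle_graph n)"
  then show "fst e \<noteq> snd e"
    using assms by (auto simp: cycle_graph_def mod_Suc split: if_splits)
qed (auto simp: cycle_graph_def)

lemma pair_graph_cartesian_product:
  assumes "pair_graph G" "pair_graph H"
  shows "pair_graph (cartesian_product G H)"
proof -
  interpret G: pair_graph G by fact
  interpret H: pair_graph H by fact
  have *: "parcs (cartesian_product G H) \<subseteq> 
      (pverts G \<times> pverts H) \<times> (pverts G \<times> pverts H)"
    by (auto simp: cartesian_product_def dest: G.in_arcsD1 G.in_arcsD2 H.in_arcsD1 H.in_arcsD2)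
  have sG: "(a, b) \<in> parcs G \<Longrightarrow> (b, a) \<in> parcs G" for a b
    using G.pair_sym_arcs by (auto simp: symmetric_def dest: symD)
  have sH: "(a, b) \<in> parcs H \<Longrightarrow> (b, a) \<in> parcs H" for a b
    using H.pair_sym_arcs by (auto simp: symmetric_def dest: symD)
  show ?thesis
  proof
    show "finite (parcs (cartesian_product G H))"
      by (rule finite_subset[OF *]) (simp add: G.pair_finite_verts H.pair_finite_verts)
    show "symmetric (cartesian_product G H)"
      by (auto simp: symmetric_def cartesian_product_def sG sH intro!: symI)
    fix e assume "e \<in> parcs (cartesian_product G H)"
    then show "fst e \<noteq> snd e" "fst e \<in> pverts (cartesian_product G H)"
        "snd e \<in> pverts (cartesian_product G H)"
      by (auto simp: cartesian_product_def dest: G.pair_no_loops H.pair_no_loops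
          G.in_arcsD1 G.in_arcsD2 H.in_arcsD1 H.in_arcsD2)
  qed (simp add: cartesian_product_def G.pair_finite_verts H.pair_finite_verts)
qed

text \<open>The minimum in the definition of treewidth is attained.\<close>
lemma treewidth_attained:
  assumes "pair_graph G"
  obtains T :: "nat pair_pre_digraph" and V
  where "tree_decomposition G T V" "decomposition_width T V = treewidth G"
    "\<And>(T' :: nat pair_pre_digraph) V'. tree_decomposition G T' V' \<Longrightarrow>
       treewidth G \<le> decomposition_width T' V'"
proof -
  interpret G: pair_graph G by fact
  define W where "W = {decomposition_width T V | (T :: nat pair_pre_digraph) V.
    tree_decomposition G T V}"
  let ?T = "\<lparr> pverts = {0::nat}, parcs = {} \<rparr>"
  have tree: "undirected_tree ?T"
  proof -
    have "pair_graph ?T" by unfold_locales (auto simp: symmetric_def sym_def)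
    moreover have "connected ?T"
      by (auto simp: connected_def strongly_connected_def mk_symmetric_def reachable_def)
    ultimately show ?thesis
      by (auto simp: undirected_tree_def)
  qed
  have "tree_decomposition G ?T (\<lambda>_. pverts G)"
    using tree by (auto simp: tree_decomposition_def dest: G.in_arcsD1 G.in_arcsD2)
  then have ne: "W \<noteq> {}" by (auto simp: W_def)
  have lb: "-1 \<le> w" if "w \<in> W" for w
  proof -
    obtain T :: "nat pair_pre_digraph" and V
      where w: "w = decomposition_width T V" and td: "tree_decomposition G T V"
      using \<open>w \<in> W\<close> by (auto simp: W_def)
    then have "pair_graph T" "connected T"
      by (auto simp: tree_decomposition_def undirected_tree_def)
    then have fin: "finite (pverts T)" and "pverts T \<noteq> {}"
      by (auto simp: pair_graph_def pair_digraph_def pair_fin_digraph_def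
          pair_fin_digraph_axioms_def connected_def strongly_connected_def mk_symmetric_def)
    then obtain t where "t \<in> pverts T" by blast
    then have "int (card (V t)) - 1 \<le> w"
      unfolding w decomposition_width_def using fin by (intro Max_ge) auto
    then show ?thesis by simp
  qed
  obtain w where w: "w \<in> W" "\<And>w'. w' \<in> W \<Longrightarrow> w \<le> w'"
  proof -
    obtain w0 where "w0 \<in> W" using ne by blast
    define F where "F = W \<inter> {-1..w0}"
    have F: "finite F" "F \<noteq> {}" using \<open>w0 \<in> W\<close> lb by (auto simp: F_def)
    have "Min F \<le> w'" if "w' \<in> W" for w'
    proof (cases "w' \<le> w0")
      case True
      then show ?thesis using F that lb by (auto simp: F_def intro!: Min_le)
    next
      case False
      have "Min F \<le> w0" using F Min_in[OF F] by (auto simp: F_def)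
      then show ?thesis using False by simp
    qed
    moreover have "Min F \<in> W" using Min_in[OF F] by (auto simp: F_def)
    ultimately show ?thesis using that by blast
  qed
  have "treewidth G = w"
    unfolding treewidth_def
  proof (rule Least_equality)
    show "\<exists>(T :: nat pair_pre_digraph) V. tree_decomposition G T V \<and> w = decomposition_width T V"
      using w(1) by (auto simp: W_def)
  next
    fix y assume "\<exists>(T :: nat pair_pre_digraph) V. tree_decomposition G T V \<and> y = decomposition_width T V"
    then show "w \<le> y" by (intro w(2)) (auto simp: W_def)
  qed
  moreover obtain T :: "nat pair_pre_digraph" and V
    where "w = decomposition_width T V" "tree_decomposition G T V"
    using w(1) by (auto simp: W_def)
  moreover have "w \<le> decomposition_width T' V'"
    if "tree_decomposition G T' V'" for T' :: "nat pair_pre_digraph" and V'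
    using that by (intro w(2)) (auto simp: W_def)
  ultimately show thesis using that by metis
qed

end

theory Submission
  imports Defs
begin

text \<open>
  A tree decomposition with bags of size at most \<open>k\<close> is impossible if every set of at most \<open>k\<close> vertices
  misses some member of a family of connected sets, while fewer than \<open>k\<close> vertices never separate two
  members they miss: the members missed by the bags orient the edges of the tree, and an edge oriented
  both ways yields a separator. For \<open>n \<le> m\<close> the family consists of connected sets containing one or two
  columns up to a vertex. Counting shows that \<open>X\<close> leaves many lines free up to a single vertex, and a
  column and a row, each up to a vertex, touch unless both miss their common vertex. For \<open>5 \<times> 4\<close> further
  sets are needed to reach \<open>8\<close>.

  For the upper bound \<open>2 n\<close> one sweeps column by column, keeping one column in all bags. For \<open>m = n\<close> one
  saves a vertex by growing a diamond from a vertex to its antipode: each column (in the first half) or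
  row (in the second half) meets the boundary in at most two vertices, and one of them in at most one.
\<close>

section \<open>Tree decompositions over rooted trees\<close>

text \<open>The thresholds come from one count: if \<open>X\<close> meets each of \<open>N\<close>
  parallel lines, at least \<open>2 * N - card X\<close> of them are met exactly once. The criterion
  wants a missed member for every set of at most \<open>k\<close> vertices, but connections only
  around fewer than \<open>k\<close>, because two distinct bags of size at most \<open>k\<close>
  share fewer than \<open>k\<close> vertices. With single columns, the row linking two members must
  dodge the vertex omitted from each; this takes three candidate rows and gives
  \<open>2 * n - 2\<close>. A member with two columns links to any row up to a vertex, so linking
  works below \<open>2 * n\<close>. The difficulty moves to finding such a member off
  \<open>S\<close>, since its columns must also be connected off \<open>S\<close>: possible for
  \<open>card S \<le> 2 * n - 1\<close> if \<open>n < m\<close>, and for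
  \<open>card S \<le> 2 * n\<close> if \<open>n + 2 \<le> m\<close>. On the
  \<open>5 \<times> 4\<close> torus eight vertices may leave just two columns met once and no free
  connection between them; the further sets are made to catch this configuration.\<close>

definition rooted_tree :: "nat \<Rightarrow> (nat \<Rightarrow> nat) \<Rightarrow> nat pair_pre_digraph" where
  "rooted_tree N p = \<lparr> pverts = {..<N},
     parcs = {(i, j). i < N \<and> j < N \<and> (0 < i \<and> j = p i \<or> 0 < j \<and> i = p j)} \<rparr>"

text \<open>Numbering parents before children makes the path condition local: all descendants of
  \<open>i\<close> are at least \<open>i\<close>, so the path from \<open>i\<close> to any
  \<open>j < i\<close> begins with the step to \<open>p i\<close>.\<close>

definition rooted_decomposition ::
  "'a pair_pre_digraph \<Rightarrow> nat \<Rightarrow> (nat \<Rightarrow> nat) \<Rightarrow> (nat \<Rightarrow> 'a set) \<Rightarrow> bool" where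
  "rooted_decomposition G N p W \<longleftrightarrow> 0 < N \<and> (\<forall>i<N. 0 < i \<longrightarrow> p i < i) \<and>
     (\<Union>i<N. W i) = pverts G \<and>
     (\<forall>(u, v)\<in>parcs G. \<exists>i<N. u \<in> W i \<and> v \<in> W i) \<and>
     (\<forall>i<N. \<forall>j<i. W i \<inter> W j \<subseteq> W (p i))"

lemma vwalk_append_adjacent:
  assumes "vwalk (xs @ x # y # ys) T"
  shows "(x, y) \<in> arcs_ends T"
proof -
  have "vwalk_arcs (xs @ x # y # ys) = vwalk_arcs (xs @ [x]) @ (x, y) # vwalk_arcs (y # ys)"
    using vwalk_arcs_append[of "xs @ [x]" "y # ys"] by simp
  then show ?thesis using assms by (auto simp: vwalk_def)
qed

lemma rooted_tree_parent:
  assumes p: "\<forall>i<N. 0 < i \<longrightarrow> p i < i"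
    and e: "(i, j) \<in> parcs (rooted_tree N p) \<or> (j, i) \<in> parcs (rooted_tree N p)" and "j \<le> i"
  shows "j = p i" "0 < i" "i < N"
proof -
  have "i < N" "j < N" "0 < i \<and> j = p i \<or> 0 < j \<and> i = p j"
    using e by (auto simp: rooted_tree_def)
  moreover have "\<not> (0 < j \<and> i = p j)" using p \<open>j < N\<close> \<open>j \<le> i\<close> by auto
  ultimately show "j = p i" "0 < i" "i < N" by auto
qed

text \<open>A largest node inside the path would have two distinct neighbours on it, both equal to
  its parent.\<close>

lemma vpath_rooted_tree_Max:
  assumes p: "\<forall>i<N. 0 < i \<longrightarrow> p i < i"
    and q: "vpath q (rooted_tree N p)"
  shows "Max (set q) = hd q \<or> Max (set q) = last q"
proof (rule ccontr)
  let ?M = "Max (set q)"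
  assume neg: "\<not> ?thesis"
  have ne: "q \<noteq> []" using q by (auto simp: vpath_def vwalk_def)
  then have "?M \<in> set q" by simp
  then obtain as bs where q1: "q = as @ ?M # bs" by (meson split_list)
  have "as \<noteq> []" using q1 neg by (metis append_Nil list.sel(1))
  then obtain as' x where as: "as = as' @ [x]" by (meson rev_exhaust)
  have "bs \<noteq> []" using q1 neg by (metis last_snoc)
  then obtain y bs' where bs: "bs = y # bs'" by (meson neq_Nil_conv)
  have q2: "q = as' @ x # ?M # y # bs'" using q1 as bs by simp
  then have q3: "q = (as' @ [x]) @ ?M # y # bs'" by simp
  have walk: "vwalk q (rooted_tree N p)" and dist: "distinct q" using q by auto
  have e1: "(x, ?M) \<in> parcs (rooted_tree N p)"
    using walk q2 vwalk_append_adjacent[of as' x ?M "y # bs'"] by (metis with_proj_simps(3))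
  have e2: "(?M, y) \<in> parcs (rooted_tree N p)"
    using walk q3 vwalk_append_adjacent[of "as' @ [x]" ?M y bs'] by (metis with_proj_simps(3))
  have "x \<in> set q" "y \<in> set q" using q2 by (metis in_set_conv_decomp)(metis q2 bs in_set_conv_decomp q1 list.set_intros(1) list.set_intros(2) Un_iff set_append)
  then have le: "x \<le> ?M" "y \<le> ?M" by simp_all
  have ne: "x \<noteq> y" using dist q2
    by (metis distinct.simps(2) distinct_append list.set_intros(1) list.set_intros(2))
  have "x = p ?M" using e1 le rooted_tree_parent[OF p] by blast
  moreover have "y = p ?M" using e2 le rooted_tree_parent[OF p] by blast
  ultimately show False using ne by simp
qed

text \<open>Acyclicity: by \<open>vpath_rooted_tree_Max\<close> the largest node of a cycle is an
  end of the path, and with the closing arc it has two different neighbours on the cycle that would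
  both be its parent.\<close>

lemma undirected_tree_rooted_tree:
  assumes N: "0 < N" and p: "\<forall>i<N. 0 < i \<longrightarrow> p i < i"
  shows "undirected_tree (rooted_tree N p)"
proof -
  let ?T = "rooted_tree N p"
  have sym: "symmetric (with_proj ?T)"
    by (auto simp: rooted_tree_def symmetric_def intro!: symI)
  have pg: "pair_graph ?T"
  proof
    show "finite (parcs ?T)"
      by (rule finite_subset[of _ "{..<N} \<times> {..<N}"]) (auto simp: rooted_tree_def)
    fix e assume "e \<in> parcs ?T"
    then show "fst e \<noteq> snd e" using p by (auto simp: rooted_tree_def)
  qed (use sym in \<open>auto simp: rooted_tree_def\<close>)
  interpret pair_graph ?T by fact
  have verts: "pverts ?T = {..<N}" by (simp add: rooted_tree_def)
  have "connected ?T"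
  proof -
    have root: "0 \<rightarrow>\<^sup>*\<^bsub>?T\<^esub> i" if "i < N" for i using that
    proof (induction i rule: less_induct)
      case (less i)
      show ?case
      proof (cases "i = 0")
        case True
        moreover have "0 \<in> pverts ?T" using N by (simp add: rooted_tree_def)
        ultimately show ?thesis by (auto intro: reachable_refl)
      next
        case False
        then have "0 \<rightarrow>\<^sup>*\<^bsub>?T\<^esub> p i" using less p by fastforce
        moreover have "(p i, i) \<in> parcs ?T" using False less p by (fastforce simp: rooted_tree_def)
        ultimately show ?thesis using reachable_adj_trans by blast
      qed
    qed
    have "i \<rightarrow>\<^sup>*\<^bsub>?T\<^esub> j" if "i < N" "j < N" for i j
      using root[OF that(1)] root[OF that(2)] reachable_trans symmetric_reachable[OF sym] by blast
    then show ?thesis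
      using N verts by (intro connectedI) (auto intro: reachable_mk_symmetricI)
  qed
  moreover have False if q: "vpath q ?T" "length q \<ge> 3" "(last q, hd q) \<in> parcs ?T" for q
  proof -
    obtain x y bs where q1: "q = x # y # bs" "bs \<noteq> []" using q(2)
      by (cases q; cases "tl q"; cases "tl (tl q)") auto
    then obtain as z w where q2: "q = as @ [z, w]" "as \<noteq> []"
      by (metis append_butlast_last_id append_Cons append_Nil append_assoc list.distinct(1) list.inject q(2) butlast_snoc append_is_Nil_conv)
    have walk: "vwalk q ?T" and dist: "distinct q" using q by auto
    have e1: "(x, y) \<in> parcs ?T"
      using walk q1 vwalk_append_adjacent[of "[]" x y bs] by simp
    have e2: "(z, w) \<in> parcs ?T"
      using walk q2 vwalk_append_adjacent[of as z w "[]" "with_proj ?T"] by simp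
    have "last q = w" "hd q = x" using q2(1) apply simp using q1(1) by simp
    then have e3: "(w, x) \<in> parcs ?T" using q(3) by simp
    have mem: "y \<in> set q" "z \<in> set q" "x \<in> set q" "w \<in> set q"
      using q1(1) apply simp using q2(1) apply simp using q1(1) apply simp using q2(1) by simp
    have w: "w = last bs" using q1 q2 by (metis last.simps last_snoc list.distinct(1) append_Cons append_Nil append_assoc)
    have yw: "y \<noteq> w" using w q1 dist by auto
    have zx: "z \<noteq> x"
    proof -
      have "x \<in> set as" using q1 q2 by (metis hd_append2 hd_in_set list.sel(1))
      then show ?thesis using q2 dist by auto
    qed
    from vpath_rooted_tree_Max[OF p q(1)] consider "Max (set q) = x" | "Max (set q) = w"
      using q1 q2 by (metis last_snoc list.sel(1) append_Cons append_Nil append_assoc)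
    then show False
    proof cases
      case 1
      then have "y \<le> x" "w \<le> x" using mem by (auto intro: Max_ge)
      then have "y = p x" "w = p x" using e1 e3 rooted_tree_parent[OF p] by blast+
      then show False using yw by simp
    next
      case 2
      then have "z \<le> w" "x \<le> w" using mem by (auto intro: Max_ge)
      then have "z = p w" "x = p w" using e2 e3 rooted_tree_parent[OF p] by blast+
      then show False using zx by simp
    qed
  qed
  ultimately show ?thesis using pg by (auto simp: undirected_tree_def)
qed

text \<open>Induction on the length of the path. One end is the largest node, so the node next to it
  is its parent, which inherits \<open>v\<close> by the last condition of
  \<open>rooted_decomposition\<close>; the end can then be dropped.\<close>

lemma tree_decomposition_rooted_tree:
  assumes "rooted_decomposition G N p W"
  shows "tree_decomposition G (rooted_tree N p) W"
proof -
  let ?T = "rooted_tree N p"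
  have N: "0 < N" and p: "\<forall>i<N. 0 < i \<longrightarrow> p i < i"
    and W: "\<And>i j. i < N \<Longrightarrow> j < i \<Longrightarrow> W i \<inter> W j \<subseteq> W (p i)"
    using assms by (auto simp: rooted_decomposition_def)
  interpret T: pair_graph ?T
    using undirected_tree_rooted_tree[OF N p] by (simp add: undirected_tree_def)
  have verts: "pverts ?T = {..<N}" by (simp add: rooted_tree_def)
  have "\<forall>t\<in>set q. v \<in> W t" if "vpath q ?T" "v \<in> W (hd q)" "v \<in> W (last q)" for q v
    using that
  proof (induction q rule: length_induct)
    case (1 q)
    have walk: "vwalk q ?T" and dist: "distinct q" using 1 by auto
    have ne: "q \<noteq> []" and sub: "set q \<subseteq> {..<N}" using walk verts by (auto simp: vwalk_def)
    from vpath_rooted_tree_Max[OF p 1(2)] show ?case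
    proof
      assume M: "Max (set q) = hd q"
      show ?case
      proof (cases "tl q")
        case Nil
        then show ?thesis using ne 1 by (metis list.set_cases list.sel(1,3) set_ConsD empty_iff list.set(1))
      next
        case (Cons y ys)
        then obtain x where q: "q = x # y # ys" using ne by (metis list.collapse)
        have "(x, y) \<in> parcs ?T" using walk q vwalk_append_adjacent[of "[]" x y ys] by simp
        moreover have "y \<le> x" using M q by (metis List.finite_set Max_ge list.sel(1) list.set_intros(1,2))
        ultimately have y: "y = p x" "0 < x" "x < N" using rooted_tree_parent[OF p] by blast+
        have "last q \<in> set q" using ne by simp
        moreover have "last q \<noteq> x" using q dist by auto
        ultimately have "last q < x" using M q
          by (metis List.finite_set Max_ge list.sel(1) nless_le)
        then have "v \<in> W y" using W[OF y(3), of "last q"] 1 q y by auto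
        moreover have "vpath (y # ys) ?T" using q walk dist
          by (auto simp: vpath_def vwalk_def)
        ultimately have "\<forall>t\<in>set (y # ys). v \<in> W t"
          using 1(1)[rule_format, of "y # ys"] 1(4) q by auto
        then show ?thesis using q 1 by auto
      qed
    next
      assume M: "Max (set q) = last q"
      show ?case
      proof (cases "butlast q")
        case Nil
        then show ?thesis using ne 1
          by (metis append_Nil append_butlast_last_id empty_iff list.set(1) set_ConsD)
      next
        case (Cons y0 ys0)
        define x where "x = last q"
        obtain ys y where ys: "butlast q = ys @ [y]" using Cons by (metis list.distinct(1) rev_exhaust)
        have q: "q = ys @ [y, x]" using ys ne x_def
          by (metis append_Cons append_Nil append_assoc append_butlast_last_id)
        have "(y, x) \<in> parcs ?T"
          using walk q vwalk_append_adjacent[of ys y x "[]" "with_proj ?T"] by simp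
        moreover have "y \<le> x" using M q x_def by (metis List.finite_set Max_ge in_set_conv_decomp)
        ultimately have y: "y = p x" "0 < x" "x < N" using rooted_tree_parent[OF p] by blast+
        have hd: "hd q = hd (ys @ [y])" using q by (cases ys) auto
        then have "hd q \<in> set (ys @ [y])" by (metis hd_in_set snoc_eq_iff_butlast)
        then have "hd q \<noteq> x" using q dist by auto
        moreover have "hd q \<in> set q" using ne by simp
        ultimately have "hd q < x" using M x_def
          by (metis List.finite_set Max_ge nless_le)
        then have "v \<in> W y" using W[OF y(3), of "hd q"] 1 x_def y by auto
        moreover have "vpath (ys @ [y]) ?T" using q walk dist set_vwalk_arcs_append1[of "ys @ [y]" "[x]"]
          by (auto simp: vpath_def vwalk_def)
        ultimately have "\<forall>t\<in>set (ys @ [y]). v \<in> W t"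
          using 1(1)[rule_format, of "ys @ [y]"] 1(3) hd unfolding q by simp
        moreover have "set q = insert x (set (ys @ [y]))" using q by auto
        ultimately show ?thesis using 1(4) x_def by auto
      qed
    qed
  qed
  then show ?thesis
    using assms undirected_tree_rooted_tree[OF N p]
    by (auto simp: tree_decomposition_def rooted_decomposition_def verts Ball_def Bex_def)
qed

lemma treewidth_le:
  assumes "pair_graph G" "rooted_decomposition G N p W"
    and "\<And>i. i < N \<Longrightarrow> int (card (W i)) \<le> k + 1"
  shows "treewidth G \<le> k"
proof -
  have "N > 0" using assms(2) by (auto simp: rooted_decomposition_def)
  then have "decomposition_width (rooted_tree N p) W \<le> k"
    using assms(3) unfolding decomposition_width_def rooted_tree_def
    by (subst Max_le_iff) (auto simp: lessThan_empty_iff dest!: assms(3))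
  moreover have "treewidth G \<le> decomposition_width (rooted_tree N p) W"
    using treewidth_attained[OF assms(1)] tree_decomposition_rooted_tree[OF assms(2)] by metis
  ultimately show ?thesis by simp
qed

text \<open>Brings an arbitrary decomposition into numbered form, so that the lower bound can argue
  about descendants. The bags stay the same; \<open>x\<close> only renames the nodes.\<close>

lemma tree_decomposition_imp_rooted:
  fixes T :: "'t pair_pre_digraph"
  assumes "tree_decomposition G T V"
  obtains N p x where "rooted_decomposition G N p (V \<circ> x)" "x ` {..<N} = pverts T"
proof -
  have "undirected_tree T" using assms by (simp add: tree_decomposition_def)
  then interpret T: pair_graph T by (simp add: undirected_tree_def)
  have conn: "connected T" using \<open>undirected_tree T\<close> by (simp add: undirected_tree_def)
  have path: "v \<in> V t" if "v \<in> V (hd q)" "v \<in> V (last q)" "vpath q T" "t \<in> set q" for v q t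
  proof -
    have "set q \<subseteq> pverts T" "q \<noteq> []" using that by (auto simp: vpath_def vwalk_def)
    then have "hd q \<in> pverts T" "last q \<in> pverts T" by (auto simp: subset_iff)
    then show ?thesis using assms that unfolding tree_decomposition_def by blast
  qed
  \<comment> \<open>a connected part of the tree is enumerated so that each node has an earlier neighbour\<close>
  define ok where "ok N p x \<longleftrightarrow> 0 < N \<and> inj_on x {..<N} \<and> x ` {..<N} \<subseteq> pverts T \<and>
    (\<forall>i<N. 0 < i \<longrightarrow> p i < i \<and> (x i, x (p i)) \<in> parcs T)" for N p and x :: "nat \<Rightarrow> 't"
  \<comment> \<open>The bound \<open>max i j\<close> is what counts: it keeps \<open>x i\<close> off
    the path from its parent to an earlier node. Then \<open>x i\<close> can be put in front, and
    the path condition applies at \<open>x (p i)\<close>.\<close>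
  have walk: "\<exists>q. vpath q T \<and> hd q = x i \<and> last q = x j \<and> set q \<subseteq> x ` {..max i j}"
    if ok: "ok N p x" and "i < N" "j < N" for N p x i j
    using that(2,3)
  proof (induction "i + j" arbitrary: i j rule: less_induct)
    case less
    have inj: "x a = x b \<longleftrightarrow> a = b" if "a < N" "b < N" for a b
      using ok that by (auto simp: ok_def inj_on_def)
    have V: "x a \<in> pverts T" if "a < N" for a using ok that by (auto simp: ok_def)
    consider "i = j" | "i < j" | "j < i" by linarith
    then show ?case
    proof cases
      case 1
      then show ?thesis using V[OF less(2)]
        by (intro exI[of _ "[x i]"]) (auto simp: vpath_def vwalk_def)
    next
      case 2
      then have pj: "p j < j" "(x j, x (p j)) \<in> parcs T" using ok less by (auto simp: ok_def)
      have lt: "i + p j < i + j" and pN: "p j < N" using pj(1) less.prems by simp_all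
      from less.hyps[OF lt less.prems(1) pN]
      obtain q where q: "vpath q T" "hd q = x i" "last q = x (p j)" "set q \<subseteq> x ` {..max i (p j)}"
        by (elim exE conjE)
      have "x j \<notin> set q"
      proof
        assume "x j \<in> set q"
        then obtain k where k: "x j = x k" "k \<le> max i (p j)" using q(4) by blast
        then have "k < j" using 2 pj(1) by auto
        then show False using k(1) inj[of j k] less.prems by auto
      qed
      then have "vpath (q @ [x j]) T" using q pj V[OF less(3)] T.arcs_symmetric
        by (auto simp: vpath_def vwalk_def vwalk_arcs_append)
      moreover have "hd (q @ [x j]) = x i" using q(1,2) by (auto simp: vpath_def vwalk_def)
      moreover have "set (q @ [x j]) \<subseteq> x ` {..max i j}" using q(4) 2 pj by fastforce
      ultimately show ?thesis by (metis last_snoc)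
    next
      case 3
      then have pi: "p i < i" "(x i, x (p i)) \<in> parcs T" using ok less by (auto simp: ok_def)
      have lt: "p i + j < i + j" and pN: "p i < N" using pi(1) less.prems by simp_all
      from less.hyps[OF lt pN less.prems(2)]
      obtain q where q: "vpath q T" "hd q = x (p i)" "last q = x j" "set q \<subseteq> x ` {..max (p i) j}"
        by (elim exE conjE)
      have "x i \<notin> set q"
      proof
        assume "x i \<in> set q"
        then obtain k where k: "x i = x k" "k \<le> max (p i) j" using q(4) by blast
        then have "k < i" using 3 pi(1) by auto
        then show False using k(1) inj[of i k] less.prems by auto
      qed
      then have "vpath (x i # q) T" using q pi V[OF less(2)]
        by (auto simp: vpath_def vwalk_def)
      moreover have "last (x i # q) = x j" using q(1,3) by (auto simp: vpath_def vwalk_def)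
      moreover have "set (x i # q) \<subseteq> x ` {..max i j}" using q(4) 3 pi by fastforce
      ultimately show ?thesis by (metis list.sel(1))
    qed
  qed
  have grow: "\<exists>p x. ok (Suc n) p x" if "Suc n \<le> card (pverts T)" for n
    using that
  proof (induction n)
    case 0
    then obtain r where "r \<in> pverts T" by fastforce
    then show ?case by (intro exI[of _ "\<lambda>_. 0"] exI[of _ "\<lambda>_. r"]) (auto simp: ok_def inj_on_def)
  next
    case (Suc n)
    then obtain p x where ok: "ok (Suc n) p x" by auto
    let ?A = "x ` {..<Suc n}"
    have "card ?A = Suc n" using ok by (simp add: ok_def card_image)
    then have "?A \<noteq> pverts T" "?A \<subseteq> pverts T" using Suc.prems ok by (auto simp: ok_def)
    then obtain b where b: "b \<in> pverts T" "b \<notin> ?A" by blast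
    have "x 0 \<in> pverts T" using ok by (auto simp: ok_def)
    then have "x 0 \<rightarrow>\<^sup>*\<^bsub>T\<^esub> b"
      using conn b(1) T.reachable_mk_symmetric_eq[OF T.sym_arcs]
      by (simp add: connected_def strongly_connected_def)
    \<comment> \<open>A walk from \<open>x 0\<close> to an unlisted node leaves the listed part
      along some arc, which supplies the next node and its parent.\<close>
    then have "\<exists>u\<in>?A. \<exists>w. w \<notin> ?A \<and> (u, w) \<in> parcs T" using b(2)
    proof (induction rule: T.reachable_induct)
      case base
      then show ?case by auto
    next
      case (step u w)
      then show ?case by (cases "u \<in> ?A") auto
    qed
    then obtain i w where iw: "i < Suc n" "w \<notin> ?A" "(x i, w) \<in> parcs T" by blast
    have "w \<in> pverts T" using iw T.in_arcsD2 by blast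
    define p' where "p' = p(Suc n := i)"
    define x' where "x' = x(Suc n := w)"
    have "inj_on x' {..<Suc (Suc n)}"
      using ok iw by (auto simp: ok_def x'_def inj_on_def less_Suc_eq)
    moreover have "x' ` {..<Suc (Suc n)} \<subseteq> pverts T"
      using ok \<open>w \<in> pverts T\<close> by (auto simp: ok_def x'_def less_Suc_eq)
    moreover have "p' k < k \<and> (x' k, x' (p' k)) \<in> parcs T" if "k < Suc (Suc n)" "0 < k" for k
    proof (cases "k = Suc n")
      case True
      then show ?thesis using iw T.arcs_symmetric by (auto simp: p'_def x'_def)
    next
      case False
      then have "p k < k" "(x k, x (p k)) \<in> parcs T" using ok that by (auto simp: ok_def)
      then show ?thesis using False that by (auto simp: p'_def x'_def)
    qed
    ultimately have "ok (Suc (Suc n)) p' x'" by (auto simp: ok_def)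
    then show ?case by blast
  qed
  have "pverts T \<noteq> {}" using conn by (auto simp: connected_def strongly_connected_def)
  then have pos: "0 < card (pverts T)" using T.pair_finite_verts by (simp add: card_gt_0_iff)
  define N where "N = card (pverts T)"
  obtain p x where ok: "ok N p x" using grow[of "N - 1"] pos by (auto simp: N_def)
  have im: "x ` {..<N} = pverts T"
    using ok T.pair_finite_verts by (intro card_subset_eq) (auto simp: ok_def N_def card_image)
  have "V (x i) \<inter> V (x j) \<subseteq> V (x (p i))" if ij: "i < N" "j < i" for i j
  proof
    fix v assume v: "v \<in> V (x i) \<inter> V (x j)"
    have pi: "p i < i" "(x i, x (p i)) \<in> parcs T" using ok that by (auto simp: ok_def)
    obtain q where q: "vpath q T" "hd q = x (p i)" "last q = x j" "set q \<subseteq> x ` {..max (p i) j}"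
      using walk[OF ok order.strict_trans[OF pi(1) ij(1)] order.strict_trans[OF ij(2,1)]]
      by (elim exE conjE)
    have "x i \<notin> set q"
    proof
      assume "x i \<in> set q"
      then obtain k where k: "x i = x k" "k \<le> max (p i) j" using q(4) by blast
      then have "k < i" using that pi by auto
      then have "k < N" "k \<noteq> i" using that by auto
      then show False using k ok that by (auto simp: ok_def inj_on_def)
    qed
    then have "vpath (x i # q) T" using q pi T.in_arcsD1 by (auto simp: vpath_def vwalk_def)
    moreover have "last (x i # q) = x j" "x (p i) \<in> set q"
      using q by (auto simp: vpath_def vwalk_def) (metis hd_in_set q(2))
    ultimately show "v \<in> V (x (p i))" using path[of v "x i # q"] v by auto
  qed
  moreover have "(\<Union>i<N. V (x i)) = pverts G"
    using assms unfolding tree_decomposition_def im[symmetric] by (simp add: image_image)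
  moreover have "\<exists>i<N. u \<in> V (x i) \<and> v \<in> V (x i)" if "(u, v) \<in> parcs G" for u v
  proof -
    obtain t where "t \<in> pverts T" "u \<in> V t" "v \<in> V t"
      using assms \<open>(u, v) \<in> parcs G\<close> unfolding tree_decomposition_def by blast
    then show ?thesis unfolding im[symmetric] by blast
  qed
  moreover have "0 < N" "\<forall>i<N. 0 < i \<longrightarrow> p i < i" using ok by (simp_all add: ok_def)
  ultimately have "rooted_decomposition G N p (V \<circ> x)"
    unfolding rooted_decomposition_def by auto
  then show thesis using im that by blast
qed

section \<open>The lower bound criterion\<close>

text \<open>Connectedness of the induced subgraph. The empty set counts as linked, so nonemptiness
  is demanded separately where it matters.\<close>

definition linked :: "'a pair_pre_digraph \<Rightarrow> 'a set \<Rightarrow> bool" where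
  "linked G A \<longleftrightarrow> (\<forall>x\<in>A. \<forall>y\<in>A. (x, y) \<in> (parcs G \<inter> A \<times> A)\<^sup>*)"

definition descendants :: "nat \<Rightarrow> (nat \<Rightarrow> nat) \<Rightarrow> nat \<Rightarrow> nat set" where
  "descendants N p d = {(p i, i) | i. 0 < i \<and> i < N}\<^sup>* `` {d}"

lemma descendants_refl: "d \<in> descendants N p d"
  by (simp add: descendants_def)

lemma parent_in_descendants:
  assumes "j \<in> descendants N p d" "j \<noteq> d"
  shows "p j \<in> descendants N p d" "0 < j" "j < N"
  using assms by (auto simp: descendants_def elim: rtranclE)

lemma descendants_step:
  assumes "p i \<in> descendants N p d" "0 < i" "i < N"
  shows "i \<in> descendants N p d"
  using assms by (auto simp: descendants_def intro: rtrancl_into_rtrancl)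

lemma descendants_root:
  assumes p: "\<forall>i<N. 0 < i \<longrightarrow> p i < i" and "j < N"
  shows "j \<in> descendants N p 0"
  using \<open>j < N\<close>
proof (induction j rule: less_induct)
  case (less j)
  then show ?case using p descendants_step[of p j N 0]
    by (cases "j = 0") (auto simp: descendants_refl)
qed

lemma descendants_less:
  assumes "d < N" "j \<in> descendants N p d"
  shows "j < N"
  using assms parent_in_descendants(3) by (cases "j = d") auto

text \<open>The larger of the two indices is replaced by its parent, whose bag still contains
  \<open>v\<close>. The two indices stay on their sides of the arc between \<open>d\<close> and
  \<open>p d\<close> until the larger one is \<open>d\<close> itself.\<close>

lemma rooted_decomposition_separation:
  assumes W: "rooted_decomposition G N p W" and d: "0 < d" "d < N"
    and "j \<in> descendants N p d" "k < N" "k \<notin> descendants N p d" "v \<in> W j" "v \<in> W k"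
  shows "v \<in> W d \<inter> W (p d)"
  using assms(4-)
proof (induction "j + k" arbitrary: j k rule: less_induct)
  case less
  have p: "p i < i" if "0 < i" "i < N" for i
    using W that by (auto simp: rooted_decomposition_def)
  have up: "v \<in> W (p i)" if "v \<in> W i" "v \<in> W l" "l < i" "i < N" for i l
    using W that unfolding rooted_decomposition_def by blast
  have j: "j < N" using descendants_less[OF d(2) less(2)] .
  consider "k < j" | "j < k" | "j = k" by linarith
  then show ?case
  proof cases
    case 1
    then have v: "v \<in> W (p j)" using up less j by blast
    show ?thesis
    proof (cases "j = d")
      case True
      then show ?thesis using v less by simp
    next
      case False
      note pj = parent_in_descendants[OF less(2) False]
      then show ?thesis using less(1)[of "p j" k] p[of j] less v by auto
    qed
  next
    case 2
    then have "v \<in> W (p k)" using up less by blast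
    moreover have "p k \<notin> descendants N p d" using descendants_step[of p k] less 2 by auto
    ultimately show ?thesis using less(1)[of j "p k"] p[of k] less 2 by auto
  next
    case 3
    then show ?thesis using less by simp
  qed
qed

text \<open>
  The set that \<open>F\<close> assigns to a bag points from this bag into one of the branches of the tree;
  two adjacent bags pointing at each other yield a small separator.
\<close>
lemma treewidth_ge:
  fixes k :: nat
  assumes G: "pair_graph G"
    and avoid: "\<And>S. S \<subseteq> pverts G \<Longrightarrow> card S \<le> k \<Longrightarrow> \<exists>L\<in>F. L \<noteq> {} \<and> L \<subseteq> pverts G \<and> L \<inter> S = {}"
    and link: "\<And>X L L'. X \<subseteq> pverts G \<Longrightarrow> card X < k \<Longrightarrow> L \<in> F \<Longrightarrow> L' \<in> F \<Longrightarrow>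
      L \<subseteq> pverts G \<Longrightarrow> L' \<subseteq> pverts G \<Longrightarrow> L \<inter> X = {} \<Longrightarrow> L' \<inter> X = {} \<Longrightarrow>
      \<exists>C. linked G C \<and> L \<union> L' \<subseteq> C \<and> C \<inter> X = {}"
  shows "int k \<le> treewidth G"
proof (rule ccontr)
  assume "\<not> ?thesis"
  then have small: "treewidth G < int k" by simp
  interpret G: pair_graph G by fact
  obtain T :: "nat pair_pre_digraph" and V
    where TV: "tree_decomposition G T V" "decomposition_width T V = treewidth G"
    using treewidth_attained[OF G] by metis
  then interpret T: pair_graph T by (simp add: tree_decomposition_def undirected_tree_def)
  have card_V: "card (V t) \<le> k" if "t \<in> pverts T" for t
  proof -
    have "int (card (V t)) - 1 \<le> decomposition_width T V"
      unfolding decomposition_width_def using that T.pair_finite_verts by (intro Max_ge) auto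
    then show ?thesis using TV(2) small by simp
  qed
  obtain N p x where W: "rooted_decomposition G N p (V \<circ> x)" and x: "x ` {..<N} = pverts T"
    using tree_decomposition_imp_rooted[OF TV(1)] .
  define W where "W = V \<circ> x"
  note W = W[folded W_def]
  have N: "0 < N" and p: "\<forall>i<N. 0 < i \<longrightarrow> p i < i" and cover: "(\<Union>i<N. W i) = pverts G"
    and edges: "\<And>u v. (u, v) \<in> parcs G \<Longrightarrow> \<exists>i<N. u \<in> W i \<and> v \<in> W i"
    using W by (auto simp: rooted_decomposition_def)
  have Wsub: "W i \<subseteq> pverts G" if "i < N" for i
    unfolding cover[symmetric] using that by blast
  have Wcard: "card (W i) \<le> k" if "i < N" for i
  proof -
    have "x i \<in> pverts T" unfolding x[symmetric] using that by blast
    then show ?thesis unfolding W_def by (simp add: card_V)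
  qed
  have Wfin: "finite (W i)" if "i < N" for i
    by (rule finite_subset[OF Wsub[OF that] G.pair_finite_verts])
  \<comment> \<open>The choice depends on the bag as a set and not on the node, so equal bags
    receive the same member.\<close>
  define \<beta> where "\<beta> S = (SOME L. L \<in> F \<and> L \<noteq> {} \<and> L \<subseteq> pverts G \<and> L \<inter> S = {})" for S
  have \<beta>: "\<beta> (W i) \<in> F \<and> \<beta> (W i) \<noteq> {} \<and> \<beta> (W i) \<subseteq> pverts G \<and> \<beta> (W i) \<inter> W i = {}" if "i < N" for i
  proof -
    have "\<exists>L. L \<in> F \<and> L \<noteq> {} \<and> L \<subseteq> pverts G \<and> L \<inter> W i = {}"
      using avoid[OF Wsub[OF that] Wcard[OF that]] by blast
    then show ?thesis unfolding \<beta>_def by (rule someI_ex)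
  qed
  define U where "U d = (\<Union>j\<in>descendants N p d. W j)" for d
  \<comment> \<open>\<open>I\<close> collects the nodes whose member reaches into the bags of their
    own subtree. For the largest such \<open>c\<close>, the child \<open>d\<close> towards a vertex
    \<open>v\<close> of that reach is outside \<open>I\<close>, so the members of \<open>c\<close>
    and \<open>d\<close> point at each other across their common arc.\<close>
  define I where "I = {i. i < N \<and> \<beta> (W i) \<inter> U i \<noteq> {}}"
  have "0 \<in> I"
  proof -
    have "pverts G \<subseteq> U 0" using cover descendants_root[OF p] by (auto simp: U_def)
    then show ?thesis using \<beta>[OF N] N by (auto simp: I_def)
  qed
  have finI: "finite I" by (auto simp: I_def)
  define c where "c = Max I"
  have "I \<noteq> {}" using \<open>0 \<in> I\<close> by blast
  then have "c \<in> I" unfolding c_def by (rule Max_in[OF finI])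
  have c_max: "\<And>i. i \<in> I \<Longrightarrow> i \<le> c" unfolding c_def by (rule Max_ge[OF finI])
  from \<open>c \<in> I\<close> obtain v j where c: "c < N" and v: "v \<in> \<beta> (W c)" "v \<in> W j" "j \<in> descendants N p c"
    by (auto simp: I_def U_def)
  have "j \<noteq> c" using v \<beta>[OF c] by blast
  then obtain d where d: "p d = c" "0 < d" "d < N" "j \<in> descendants N p d"
    using v(3) by (auto simp: descendants_def elim: converse_rtranclE)
  have "c < d" using p d by auto
  then have "d \<notin> I" using c_max by fastforce
  then have disj: "\<beta> (W d) \<inter> U d = {}" using d by (simp add: I_def)
  have vU: "v \<in> U d" using v d by (auto simp: U_def)
  define X where "X = W c \<inter> W d"
  \<comment> \<open>Equal bags would have the same member, which would both contain the vertex
    \<open>v\<close> of \<open>U d\<close> and be disjoint from \<open>U d\<close>.\<close>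
  have "W c \<noteq> W d" using disj v vU by auto
  then have "X \<subset> W c \<or> X \<subset> W d" by (auto simp: X_def)
  then have "card X < k"
    using psubset_card_mono Wfin Wcard c d(3) by (metis order_less_le_trans)
  moreover have "X \<subseteq> pverts G" using Wsub[OF c] by (auto simp: X_def)
  moreover have "\<beta> (W c) \<inter> X = {}" "\<beta> (W d) \<inter> X = {}"
    using \<beta>[OF c] \<beta>[OF d(3)] unfolding X_def by blast+
  ultimately obtain C where C: "linked G C" "\<beta> (W c) \<union> \<beta> (W d) \<subseteq> C" "C \<inter> X = {}"
    using link[of X "\<beta> (W c)" "\<beta> (W d)"] \<beta>[OF c] \<beta>[OF d(3)] by blast
  obtain w where w: "w \<in> \<beta> (W d)" using \<beta>[OF d(3)] by blast
  have "(v, w) \<in> (parcs G \<inter> C \<times> C)\<^sup>*" using C v(1) w unfolding linked_def by blast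
  \<comment> \<open>A walk inside \<open>C\<close> cannot leave \<open>U d\<close>: the last vertex
    before leaving would lie in both \<open>W d\<close> and \<open>W c\<close>, that is, in
    \<open>X\<close>.\<close>
  then have "w \<in> U d"
  proof (induction rule: rtrancl_induct)
    case base
    show ?case by fact
  next
    case (step y z)
    then obtain i where i: "i < N" "y \<in> W i" "z \<in> W i" using edges by blast
    have "i \<in> descendants N p d"
    proof (rule ccontr)
      assume "i \<notin> descendants N p d"
      moreover obtain l where "l \<in> descendants N p d" "y \<in> W l" using step by (auto simp: U_def)
      ultimately have "y \<in> W d \<inter> W (p d)"
        using rooted_decomposition_separation[OF W d(2,3)] i by blast
      then show False using C step d by (auto simp: X_def)
    qed
    then show ?case using i by (auto simp: U_def)
  qed
  then show False using disj w by blast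
qed

lemma linked_empty [simp]: "linked G {}"
  by (simp add: linked_def)

lemma linked_singleton [simp]: "linked G {x}"
  by (simp add: linked_def)

lemma linked_mono_rtrancl:
  assumes "(x, y) \<in> (parcs G \<inter> A \<times> A)\<^sup>*" "A \<subseteq> B"
  shows "(x, y) \<in> (parcs G \<inter> B \<times> B)\<^sup>*"
  using assms by (meson Int_mono Sigma_mono order_refl rtrancl_mono subsetD)

lemma linked_Un:
  assumes "symmetric (with_proj G)" "linked G A" "linked G B"
    and touch: "a \<in> A" "b \<in> B" "a = b \<or> (a, b) \<in> parcs G"
  shows "linked G (A \<union> B)"
proof -
  let ?R = "(parcs G \<inter> (A \<union> B) \<times> (A \<union> B))\<^sup>*"
  have A: "(x, y) \<in> ?R" if "x \<in> A" "y \<in> A" for x y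
    using assms(2) that linked_mono_rtrancl[of x y G A "A \<union> B"] by (auto simp: linked_def)
  have B: "(x, y) \<in> ?R" if "x \<in> B" "y \<in> B" for x y
    using assms(3) that linked_mono_rtrancl[of x y G B "A \<union> B"] by (auto simp: linked_def)
  have "sym (parcs G)" using assms(1) by (simp add: symmetric_def)
  then have ab: "(a, b) \<in> ?R" "(b, a) \<in> ?R" using touch by (auto dest: symD)
  have AB: "(x, y) \<in> ?R" if "x \<in> A" "y \<in> B" for x y
    using A[OF that(1) touch(1)] ab(1) B[OF touch(2) that(2)] by (meson rtrancl_trans)
  have BA: "(x, y) \<in> ?R" if "x \<in> B" "y \<in> A" for x y
    using B[OF that(1) touch(2)] ab(2) A[OF touch(1) that(2)] by (meson rtrancl_trans)
  show ?thesis using A B AB BA unfolding linked_def by blast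
qed

section \<open>Lines of the torus\<close>

text \<open>For nonempty \<open>A\<close> and \<open>B\<close> this says that they lie in one
  component of the graph without \<open>X\<close>.\<close>

definition joined :: "'a pair_pre_digraph \<Rightarrow> 'a set \<Rightarrow> 'a set \<Rightarrow> 'a set \<Rightarrow> bool" where
  "joined G X A B \<longleftrightarrow> (\<exists>C. linked G C \<and> A \<union> B \<subseteq> C \<and> C \<inter> X = {})"

lemma joined_sym: "joined G X A B \<Longrightarrow> joined G X B A"
  by (auto simp: joined_def)

lemma joined_touching:
  assumes "symmetric (with_proj G)" "linked G A" "linked G B" "A \<inter> X = {}" "B \<inter> X = {}"
    and "\<exists>a\<in>A. \<exists>b\<in>B. a = b \<or> (a, b) \<in> parcs G"
  shows "joined G X A B"
  using assms linked_Un[of G A B] unfolding joined_def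
  by (intro exI[of _ "A \<union> B"]) blast

lemma joined_trans:
  assumes "symmetric (with_proj G)" "joined G X A B" "joined G X B C" "B \<noteq> {}"
  shows "joined G X A C"
proof -
  obtain D E where D: "linked G D" "A \<union> B \<subseteq> D" "D \<inter> X = {}"
    and E: "linked G E" "B \<union> C \<subseteq> E" "E \<inter> X = {}"
    using assms by (auto simp: joined_def)
  then have "linked G (D \<union> E)"
    using assms(1,4) linked_Un[of G D E] by blast
  then show ?thesis
    unfolding joined_def using D E by (intro exI[of _ "D \<union> E"]) blast
qed

lemma linked_path:
  assumes "symmetric (with_proj G)" "\<And>k. Suc k < b \<Longrightarrow> (f k, f (Suc k)) \<in> parcs G"
  shows "linked G (f ` {a..<b})"
  using assms(2)
proof (induction b)
  case 0
  then show ?case by simp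
next
  case (Suc b)
  show ?case
  proof (cases "a < b")
    case True
    then have "f (b - 1) \<in> f ` {a..<b}" "(f (b - 1), f b) \<in> parcs G"
      using Suc.prems[of "b - 1"] by auto
    then have "linked G (f ` {a..<b} \<union> {f b})"
      using linked_Un[OF assms(1) _ linked_singleton[of G "f b"], of "f ` {a..<b}" "f (b - 1)" "f b"]
        Suc.IH Suc.prems by simp
    moreover have "f ` {a..<Suc b} = f ` {a..<b} \<union> {f b}"
      using True by (auto simp: atLeastLessThanSuc)
    ultimately show ?thesis by simp
  next
    case False
    then have "{a..<Suc b} = {} \<or> {a..<Suc b} = {b}" by auto
    then show ?thesis by auto
  qed
qed

text \<open>For \<open>x \<le> y\<close> this is the arc from \<open>y + 1\<close> through the
  wrap-around up to \<open>x - 1\<close>, glued from two paths at the edge between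
  \<open>n - 1\<close> and 0. With \<open>x = y\<close> it is the cycle minus one vertex.\<close>

lemma linked_cycle_arc:
  assumes sym: "symmetric (with_proj G)"
    and f: "\<And>k. k < n \<Longrightarrow> (f k, f (Suc k mod n)) \<in> parcs G"
  shows "linked G (f ` {k. k < n \<and> (k < x \<or> y < k)})"
proof -
  have step: "(f k, f (Suc k)) \<in> parcs G" if "Suc k < n" for k
    using f[of k] that by simp
  have 1: "linked G (f ` {Suc y..<n})" using step by (intro linked_path sym) auto
  have 2: "linked G (f ` {0..<min x n})" using step by (intro linked_path sym) auto
  have eq: "f ` {k. k < n \<and> (k < x \<or> y < k)} = f ` {Suc y..<n} \<union> f ` {0..<min x n}"
    by auto
  show ?thesis
  proof (cases "Suc y < n \<and> 0 < x")
    case True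
    then have "f (n - 1) \<in> f ` {Suc y..<n}" "f 0 \<in> f ` {0..<min x n}"
      "(f (n - 1), f 0) \<in> parcs G" using f[of "n - 1"] by auto
    then show ?thesis unfolding eq using linked_Un[OF sym 1 2] by blast
  next
    case False
    then have "{Suc y..<n} = {} \<or> {0..<min x n} = {}" by auto
    then show ?thesis unfolding eq using 1 2 by auto
  qed
qed

lemma linked_cycle_without:
  assumes sym: "symmetric (with_proj G)"
    and f: "\<And>k. k < n \<Longrightarrow> (f k, f (Suc k mod n)) \<in> parcs G"
  shows "linked G (f ` ({..<n} - {p}))"
proof -
  have "{..<n} - {p} = {k. k < n \<and> (k < p \<or> p < k)}" by auto
  then show ?thesis using linked_cycle_arc[where f = f and n = n and x = p and y = p, OF assms] by simp
qed

text \<open>If \<open>p\<close> is not an index of the line, nothing is removed.\<close>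

definition column_without :: "nat \<Rightarrow> nat \<Rightarrow> nat \<Rightarrow> (nat \<times> nat) set" where
  "column_without n i p = Pair i ` ({..<n} - {p})"

definition row_without :: "nat \<Rightarrow> nat \<Rightarrow> nat \<Rightarrow> (nat \<times> nat) set" where
  "row_without m j p = (\<lambda>i. (i, j)) ` ({..<m} - {p})"

lemma pverts_toroidal_grid: "pverts (toroidal_grid m n) = {..<m} \<times> {..<n}"
  by (simp add: toroidal_grid_def cartesian_product_def cycle_graph_def)

lemma parcs_toroidal_grid:
  "((a, b), (c, d)) \<in> parcs (toroidal_grid m n) \<longleftrightarrow>
     b = d \<and> b < n \<and> a < m \<and> c < m \<and> (c = Suc a mod m \<or> a = Suc c mod m) \<or>
     a = c \<and> a < m \<and> b < n \<and> d < n \<and> (d = Suc b mod n \<or> b = Suc d mod n)"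
  by (auto simp: toroidal_grid_def cartesian_product_def cycle_graph_def)

lemma card_le_1_subset_singleton:
  assumes "finite A" "card A \<le> 1"
  shows "\<exists>a. A \<subseteq> {a}"
proof (cases "A = {}")
  case False
  then obtain a where "a \<in> A" by blast
  moreover have "\<forall>x\<in>A. \<forall>y\<in>A. x = y" using assms card_le_Suc0_iff_eq[of A] by simp
  ultimately show ?thesis by blast
qed simp

locale torus =
  fixes m n :: nat
  assumes m: "3 \<le> m" and n: "3 \<le> n"
begin

abbreviation T where "T \<equiv> toroidal_grid m n"
abbreviation col where "col \<equiv> column_without n"
abbreviation row where "row \<equiv> row_without m"

lemma pair_graph_T: "pair_graph T"
  unfolding toroidal_grid_def using m n
  by (intro pair_graph_cartesian_product pair_graph_cycle_graph) auto

sublocale T: pair_graph T by (rule pair_graph_T)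

lemma sym_T: "symmetric (with_proj T)" by (rule T.sym_arcs)

lemma adj_vertical: "i < m \<Longrightarrow> j < n \<Longrightarrow> ((i, j), (i, Suc j mod n)) \<in> parcs T"
  using n by (simp add: parcs_toroidal_grid)

lemma adj_horizontal: "i < m \<Longrightarrow> j < n \<Longrightarrow> ((i, j), (Suc i mod m, j)) \<in> parcs T"
  using m by (simp add: parcs_toroidal_grid)

lemma linked_col: "i < m \<Longrightarrow> linked T (col i p)"
  unfolding column_without_def by (intro linked_cycle_without sym_T adj_vertical)

lemma linked_row: "j < n \<Longrightarrow> linked T (row j p)"
  unfolding row_without_def by (intro linked_cycle_without sym_T) (rule adj_horizontal)

lemma linked_row_arc: "j < n \<Longrightarrow> linked T ((\<lambda>i. (i, j)) ` {k. k < m \<and> (k < x \<or> y < k)})"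
  by (intro linked_cycle_arc sym_T) (rule adj_horizontal)

lemma linked_row_segment: "j < n \<Longrightarrow> y \<le> m \<Longrightarrow> linked T ((\<lambda>i. (i, j)) ` {x..<y})"
  using adj_horizontal[of _ j] by (intro linked_path sym_T) (metis Suc_lessD mod_less order_less_le_trans)

lemma mod_Suc_neq: "2 \<le> N \<Longrightarrow> k < N \<Longrightarrow> Suc k mod N \<noteq> k" for N k :: nat
  by (cases "Suc k = N") auto

text \<open>If just one of the two lines omits the crossing vertex, the next vertex on that line is
  adjacent to the crossing, which the other line contains.\<close>

lemma col_row_touch:
  assumes "i < m" "j < n" "i \<noteq> q \<or> j \<noteq> p"
  shows "\<exists>a\<in>col i p. \<exists>b\<in>row j q. a = b \<or> (a, b) \<in> parcs T"
proof (cases "i = q")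
  case True
  then have "(i, j) \<in> col i p" "(Suc i mod m, j) \<in> row j q"
    using assms m mod_Suc_neq[of m i] by (auto simp: column_without_def row_without_def)
  then show ?thesis using adj_horizontal assms by blast
next
  case False
  show ?thesis
  proof (cases "j = p")
    case True
    then have "(i, Suc j mod n) \<in> col i p" "(i, j) \<in> row j q"
      using assms n mod_Suc_neq[of n j] False by (auto simp: column_without_def row_without_def)
    then show ?thesis using adj_vertical assms T.arcs_symmetric by blast
  next
    case False
    then have "(i, j) \<in> col i p" "(i, j) \<in> row j q"
      using assms \<open>i \<noteq> q\<close> by (auto simp: column_without_def row_without_def)
    then show ?thesis by blast
  qed
qed

lemma joined_row:
  assumes "linked T L" "L \<inter> X = {}" "col i p \<subseteq> L" "row j q \<inter> X = {}"
    and "i < m" "j < n" "i \<noteq> q \<or> j \<noteq> p"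
  shows "joined T X L (row j q)"
  using col_row_touch[OF assms(5-7)] assms(3)
  by (intro joined_touching sym_T assms linked_row) blast

lemma row_nonempty: "row j q \<noteq> {}"
proof -
  have "(0, j) \<in> row j q \<or> (1, j) \<in> row j q" using m by (auto simp: row_without_def)
  then show ?thesis by blast
qed

lemma sum_columns:
  assumes "X \<subseteq> pverts T"
  shows "(\<Sum>i<m. card {j. (i, j) \<in> X}) = card X"
proof -
  have "finite {j. (i, j) \<in> X}" for i
    using finite_subset[of "{j. (i, j) \<in> X}" "{..<n}"] assms
    by (force simp: pverts_toroidal_grid)
  then have "card (SIGMA i:{..<m}. {j. (i, j) \<in> X}) = (\<Sum>i<m. card {j. (i, j) \<in> X})"
    by simp
  moreover have "(SIGMA i:{..<m}. {j. (i, j) \<in> X}) = X"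
    using assms by (auto simp: pverts_toroidal_grid)
  ultimately show ?thesis by simp
qed

lemma sum_rows:
  assumes "X \<subseteq> pverts T"
  shows "(\<Sum>j<n. card {i. (i, j) \<in> X}) = card X"
proof -
  have "finite {i. (i, j) \<in> X}" for j
    using finite_subset[of "{i. (i, j) \<in> X}" "{..<m}"] assms
    by (force simp: pverts_toroidal_grid)
  then have "card (SIGMA j:{..<n}. {i. (i, j) \<in> X}) = (\<Sum>j<n. card {i. (i, j) \<in> X})"
    by simp
  moreover have "prod.swap ` (SIGMA j:{..<n}. {i. (i, j) \<in> X}) = X"
    using assms by (force simp: pverts_toroidal_grid image_iff)
  ultimately show ?thesis using card_image[of prod.swap] by (metis inj_on_subset inj_swap subset_UNIV)
qed

lemma finite_row_section: "X \<subseteq> pverts T \<Longrightarrow> finite {i. (i, j) \<in> X}"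
  by (rule finite_subset[of _ "{..<m}"]) (auto simp: pverts_toroidal_grid)

lemma finite_column_section: "X \<subseteq> pverts T \<Longrightarrow> finite {j. (i, j) \<in> X}"
  by (rule finite_subset[of _ "{..<n}"]) (auto simp: pverts_toroidal_grid)

lemma row_avoid:
  assumes "X \<subseteq> pverts T" "card {i. (i, j) \<in> X} \<le> 1"
  obtains q where "{i. (i, j) \<in> X} \<subseteq> {q}" "row j q \<inter> X = {}"
proof -
  have "\<exists>q. {i. (i, j) \<in> X} \<subseteq> {q}"
    using card_le_1_subset_singleton[OF finite_row_section[OF assms(1)] assms(2)] .
  then show ?thesis using that by (auto simp: row_without_def)
qed

lemma column_avoid:
  assumes "X \<subseteq> pverts T" "card {j. (i, j) \<in> X} \<le> 1"
  obtains p where "{j. (i, j) \<in> X} \<subseteq> {p}" "col i p \<inter> X = {}"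
proof -
  have "\<exists>p. {j. (i, j) \<in> X} \<subseteq> {p}"
    using card_le_1_subset_singleton[OF finite_column_section[OF assms(1)] assms(2)] .
  then show ?thesis using that by (auto simp: column_without_def)
qed

lemma full_row_avoid:
  assumes "X \<subseteq> pverts T" "card {i. (i, j) \<in> X} = 0"
  shows "row j m \<inter> X = {}"
  using assms finite_row_section[OF assms(1), of j] by (auto simp: row_without_def)

lemma full_column_avoid:
  assumes "X \<subseteq> pverts T" "card {j. (i, j) \<in> X} = 0"
  shows "col i n \<inter> X = {}"
  using assms finite_column_section[OF assms(1), of i] by (auto simp: column_without_def)

text \<open>Every term other than 0 and 1 contributes at least 2. Applied to the numbers of vertices
  in the rows or columns, this is the count behind all thresholds.\<close>

lemma sum_eq_ones:
  fixes f :: "nat \<Rightarrow> nat"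
  shows "(\<exists>i<N. f i = 0) \<or> 2 * N \<le> sum f {..<N} + card {i. i < N \<and> f i = 1}"
proof (induction N)
  case (Suc N)
  have eq: "{i. i < Suc N \<and> f i = 1} =
      (if f N = 1 then insert N {i. i < N \<and> f i = 1} else {i. i < N \<and> f i = 1})"
    by (auto simp: less_Suc_eq)
  show ?case
    unfolding eq using Suc by (cases "f N") (auto simp: less_Suc_eq)
qed simp

lemma column_ones:
  assumes "X \<subseteq> pverts T" "\<And>i. i < m \<Longrightarrow> card {j. (i, j) \<in> X} \<noteq> 0"
  shows "2 * m \<le> card X + card {i. i < m \<and> card {j. (i, j) \<in> X} = 1}"
  using sum_eq_ones[of m "\<lambda>i. card {j. (i, j) \<in> X}"] assms(2) unfolding sum_columns[OF assms(1)]
  by blast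

lemma row_ones:
  assumes "X \<subseteq> pverts T" "\<And>j. j < n \<Longrightarrow> card {i. (i, j) \<in> X} \<noteq> 0"
  shows "2 * n \<le> card X + card {j. j < n \<and> card {i. (i, j) \<in> X} = 1}"
  using sum_eq_ones[of n "\<lambda>j. card {i. (i, j) \<in> X}"] assms(2) unfolding sum_rows[OF assms(1)]
  by blast

lemma near_free_row:
  assumes "X \<subseteq> pverts T" "card X < 2 * n"
  shows "\<exists>j<n. card {i. (i, j) \<in> X} \<le> 1"
proof (rule ccontr)
  assume "\<not> ?thesis"
  then have no: "card {i. (i, j) \<in> X} \<noteq> 0" "card {i. (i, j) \<in> X} \<noteq> 1" if "j < n" for j
    using that by (metis le0 le_refl zero_le_one)+
  then have "{j. j < n \<and> card {i. (i, j) \<in> X} = 1} = {}" by blast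
  then show False using row_ones[OF assms(1) no(1)] assms(2) by (metis add.right_neutral card.empty not_less)
qed

lemma near_free_column:
  assumes "X \<subseteq> pverts T" "card X < 2 * m"
  shows "\<exists>i<m. card {j. (i, j) \<in> X} \<le> 1"
proof (rule ccontr)
  assume "\<not> ?thesis"
  then have no: "card {j. (i, j) \<in> X} \<noteq> 0" "card {j. (i, j) \<in> X} \<noteq> 1" if "i < m" for i
    using that by (metis le0 le_refl zero_le_one)+
  then have "{i. i < m \<and> card {j. (i, j) \<in> X} = 1} = {}" by blast
  then show False using column_ones[OF assms(1) no(1)] assms(2) by (metis add.right_neutral card.empty not_less)
qed

end

section \<open>Lower bounds\<close>

context torus
begin

definition containing_column :: "(nat \<times> nat) set set" where
  "containing_column = {L. linked T L \<and> (\<exists>i<m. \<exists>p. col i p \<subseteq> L)}"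

text \<open>The alternative \<open>n \<le> p\<close> lets one complete column stand in for two
  columns that each lack a vertex. In both cases a row that omits one vertex touches the set,
  because it can share an omitted crossing with at most one column.\<close>

definition containing_two_columns :: "(nat \<times> nat) set set" where
  "containing_two_columns = {L. linked T L \<and>
     (\<exists>i<m. \<exists>i'<m. \<exists>p p'. col i p \<subseteq> L \<and> col i' p' \<subseteq> L \<and> (i \<noteq> i' \<or> n \<le> p))}"

lemma col_subset: "i < m \<Longrightarrow> col i p \<subseteq> pverts T"
  by (auto simp: column_without_def pverts_toroidal_grid)

lemma col_nonempty: "col i p \<noteq> {}"
proof -
  have "(i, 0) \<in> col i p \<or> (i, 1) \<in> col i p" using n by (auto simp: column_without_def)
  then show ?thesis by blast
qed

lemma containing_column_avoid:
  assumes "S \<subseteq> pverts T" "card S < 2 * m"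
  shows "\<exists>L\<in>containing_column. L \<noteq> {} \<and> L \<subseteq> pverts T \<and> L \<inter> S = {}"
proof -
  obtain i where i: "i < m" "card {j. (i, j) \<in> S} \<le> 1" using near_free_column[OF assms] by blast
  obtain p where "col i p \<inter> S = {}" using column_avoid[OF assms(1) i(2)] .
  moreover have "col i p \<in> containing_column"
    using i(1) linked_col unfolding containing_column_def by blast
  ultimately show ?thesis
    using col_subset[OF i(1)] col_nonempty by (intro bexI[of _ "col i p"] conjI)
qed

text \<open>Unless some row is free, at least three rows are met exactly once. At most two of them
  are ruled out by the omitted vertices of the columns, which lie in rows \<open>p\<close> and
  \<open>p'\<close>.\<close>

lemma containing_column_joined:
  assumes X: "X \<subseteq> pverts T" "card X + 3 \<le> 2 * n"
    and L: "L \<in> containing_column" "L' \<in> containing_column" "L \<inter> X = {}" "L' \<inter> X = {}"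
  shows "joined T X L L'"
proof -
  obtain i p where i: "linked T L" "i < m" "col i p \<subseteq> L"
    using L by (auto simp: containing_column_def)
  obtain i' p' where i': "linked T L'" "i' < m" "col i' p' \<subseteq> L'"
    using L by (auto simp: containing_column_def)
  have "\<exists>j<n. \<exists>q. row j q \<inter> X = {} \<and> (i \<noteq> q \<or> j \<noteq> p) \<and> (i' \<noteq> q \<or> j \<noteq> p')"
  proof (cases "\<exists>j<n. card {i. (i, j) \<in> X} = 0")
    case True
    then obtain j where "j < n" "card {i. (i, j) \<in> X} = 0" by blast
    then show ?thesis using full_row_avoid[OF X(1), of j] i(2) i'(2)
      by (intro exI[of _ j] conjI exI[of _ m]) auto
  next
    case False
    let ?J = "{j. j < n \<and> card {i. (i, j) \<in> X} = 1}"
    have "3 \<le> card ?J" using row_ones[OF X(1)] False X(2) by fastforce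
    moreover have "card {p, p'} \<le> 2" by (simp add: card_insert_if)
    ultimately have "\<not> ?J \<subseteq> {p, p'}" using card_mono[of "{p, p'}" ?J] by auto
    then obtain j where j: "j < n" "card {i. (i, j) \<in> X} = 1" "j \<noteq> p" "j \<noteq> p'" by blast
    then obtain q where "row j q \<inter> X = {}" using row_avoid[OF X(1), of j] by (metis order_refl)
    then show ?thesis using j by blast
  qed
  then obtain j q where "j < n" "row j q \<inter> X = {}" "i \<noteq> q \<or> j \<noteq> p" "i' \<noteq> q \<or> j \<noteq> p'" by blast
  then show ?thesis
    using joined_row[OF i(1) L(3) i(3) _ i(2)] joined_row[OF i'(1) L(4) i'(3) _ i'(2)]
    by (meson joined_sym joined_trans row_nonempty sym_T)
qed

lemma treewidth_ge_2n_minus_2: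
  assumes "n \<le> m"
  shows "2 * int n - 2 \<le> treewidth T"
proof -
  have "int (2 * n - 2) \<le> treewidth T"
  proof (rule treewidth_ge[OF pair_graph_T, of _ containing_column])
    show "\<exists>L\<in>containing_column. L \<noteq> {} \<and> L \<subseteq> pverts T \<and> L \<inter> S = {}"
      if "S \<subseteq> pverts T" "card S \<le> 2 * n - 2" for S
      using containing_column_avoid that assms n by simp
    show "\<exists>C. linked T C \<and> L \<union> L' \<subseteq> C \<and> C \<inter> X = {}"
      if "X \<subseteq> pverts T" "card X < 2 * n - 2" "L \<in> containing_column" "L' \<in> containing_column"
        "L \<inter> X = {}" "L' \<inter> X = {}" for X L L'
      using containing_column_joined[of X L L'] that unfolding joined_def by simp
  qed
  then show ?thesis using n by simp
qed

lemma containing_two_columns_joined_row: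
  assumes "L \<in> containing_two_columns" "L \<inter> X = {}" "row j q \<inter> X = {}" "j < n"
  shows "joined T X L (row j q)"
proof -
  obtain i i' p p' where L: "linked T L" "i < m" "i' < m" "col i p \<subseteq> L" "col i' p' \<subseteq> L" "i \<noteq> i' \<or> n \<le> p"
    using assms(1) by (auto simp: containing_two_columns_def)
  then consider "i \<noteq> q \<or> j \<noteq> p" | "i' \<noteq> q \<or> j \<noteq> p'" using assms(4) by linarith
  then show ?thesis
    using joined_row[OF L(1) assms(2) L(4) assms(3) L(2) assms(4)]
      joined_row[OF L(1) assms(2) L(5) assms(3) L(3) assms(4)] by cases
qed

lemma containing_two_columns_joined:
  assumes X: "X \<subseteq> pverts T" "card X < 2 * n"
    and L: "L \<in> containing_two_columns" "L' \<in> containing_two_columns" "L \<inter> X = {}" "L' \<inter> X = {}"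
  shows "joined T X L L'"
proof -
  obtain j where j: "j < n" "card {i. (i, j) \<in> X} \<le> 1" using near_free_row[OF X] by blast
  obtain q where "row j q \<inter> X = {}" using row_avoid[OF X(1) j(2)] .
  then show ?thesis
    using containing_two_columns_joined_row[OF L(1,3) _ j(1)] containing_two_columns_joined_row[OF L(2,4) _ j(1)]
    by (meson joined_sym joined_trans row_nonempty sym_T)
qed

text \<open>The set \<open>A\<close>, in practice part of a row, welds the two columns together.
  Should it meet a column in the omitted vertex, the next vertex of the column is adjacent.\<close>

lemma containing_two_columnsI:
  assumes S: "S \<subseteq> pverts T"
    and A: "linked T A" "A \<subseteq> pverts T" "A \<inter> S = {}"
    and i: "i < m" "i' < m" "i \<noteq> i'" "card {j. (i, j) \<in> S} \<le> 1" "card {j. (i', j) \<in> S} \<le> 1"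
    and ij: "(i, j) \<in> A" "(i', j') \<in> A"
  shows "\<exists>L\<in>containing_two_columns. L \<noteq> {} \<and> L \<subseteq> pverts T \<and> L \<inter> S = {}"
proof -
  obtain p where p: "col i p \<inter> S = {}" using column_avoid[OF S i(4)] .
  obtain p' where p': "col i' p' \<inter> S = {}" using column_avoid[OF S i(5)] .
  have touch: "\<exists>a\<in>A. \<exists>b\<in>col i p. a = b \<or> (a, b) \<in> parcs T" if "i < m" "(i, j) \<in> A" for i j p
  proof (cases "j = p")
    case True
    have "j < n" using that A(2) by (auto simp: pverts_toroidal_grid)
    then have "(i, Suc j mod n) \<in> col i p" using True n mod_Suc_neq[of n j] by (auto simp: column_without_def)
    then show ?thesis using that adj_vertical \<open>j < n\<close> by blast
  next
    case False
    then have "(i, j) \<in> col i p" using that A(2) by (auto simp: column_without_def pverts_toroidal_grid)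
    then show ?thesis using that by blast
  qed
  have "linked T (A \<union> col i p)"
    using touch[OF i(1) ij(1), of p] linked_Un[OF sym_T A(1) linked_col[OF i(1), of p]] by blast
  moreover have "\<exists>a\<in>A \<union> col i p. \<exists>b\<in>col i' p'. a = b \<or> (a, b) \<in> parcs T"
    using touch[OF i(2) ij(2), of p'] by blast
  ultimately have "linked T (A \<union> col i p \<union> col i' p')"
    using linked_Un[OF sym_T _ linked_col[OF i(2), of p'], of "A \<union> col i p"] by blast
  then have "A \<union> col i p \<union> col i' p' \<in> containing_two_columns"
    unfolding containing_two_columns_def using i by blast
  moreover have "A \<union> col i p \<union> col i' p' \<subseteq> pverts T" using A(2) col_subset i by blast
  moreover have "(A \<union> col i p \<union> col i' p') \<inter> S = {}" using A(3) p p' by blast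
  moreover have "A \<union> col i p \<union> col i' p' \<noteq> {}" using ij(1) by blast
  ultimately show ?thesis by (intro bexI conjI)
qed

lemma containing_two_columns_full:
  assumes "S \<subseteq> pverts T" "i < m" "card {j. (i, j) \<in> S} = 0"
  shows "\<exists>L\<in>containing_two_columns. L \<noteq> {} \<and> L \<subseteq> pverts T \<and> L \<inter> S = {}"
proof (intro bexI conjI)
  show "col i n \<inter> S = {}" by (rule full_column_avoid[OF assms(1,3)])
  show "col i n \<noteq> {}" by (rule col_nonempty)
  show "col i n \<subseteq> pverts T" by (rule col_subset[OF assms(2)])
  show "col i n \<in> containing_two_columns"
    using linked_col[OF assms(2), of n] assms(2) unfolding containing_two_columns_def by auto
qed

lemma two_in_same_part:
  assumes "A \<inter> B = {}" "finite K" "K \<subseteq> A \<union> B" "3 \<le> card K"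
  obtains a b where "a \<in> K" "b \<in> K" "a \<noteq> b" "a \<in> A \<and> b \<in> A \<or> a \<in> B \<and> b \<in> B"
proof (rule ccontr)
  assume no: "\<not> thesis"
  have "\<forall>x\<in>K \<inter> A. \<forall>y\<in>K \<inter> A. x = y" "\<forall>x\<in>K \<inter> B. \<forall>y\<in>K \<inter> B. x = y" using no that by blast+
  then have "card (K \<inter> A) \<le> 1" "card (K \<inter> B) \<le> 1"
    using card_le_Suc0_iff_eq[of "K \<inter> A"] card_le_Suc0_iff_eq[of "K \<inter> B"] assms(2) by simp_all
  moreover have "card K = card (K \<inter> A) + card (K \<inter> B)"
    using assms by (subst card_Un_disjoint[symmetric]) (auto intro!: arg_cong[of _ _ card])
  ultimately show False using assms(4) by simp
qed

text \<open>The form \<open>{x, x}\<close> is the degenerate case of the two cutting points in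
  \<open>containing_two_columns_avoid\<close>; a row disjoint from \<open>X\<close> gets the default
  point 0.\<close>

lemma row_section_singleton:
  assumes "X \<subseteq> pverts T" "card {i. (i, j) \<in> X} \<le> 1"
  obtains x where "{i. (i, j) \<in> X} \<subseteq> {x, x}" "x < m"
proof -
  obtain q where q: "{i. (i, j) \<in> X} \<subseteq> {q}" using row_avoid[OF assms] .
  show thesis
  proof (cases "q < m")
    case True
    then show ?thesis using q that[of q] by simp
  next
    case False
    then have "{i. (i, j) \<in> X} = {}" using q assms(1) by (auto simp: pverts_toroidal_grid)
    then show ?thesis using m that[of 0] by simp
  qed
qed

text \<open>
  At most two elements of \<open>S\<close> in a row cut it into two arcs, one of which meets two of the columns.
\<close>
lemma containing_two_columns_avoid:
  assumes S: "S \<subseteq> pverts T"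
    and j: "j < n" "{i. (i, j) \<in> S} \<subseteq> {x, y}" "x \<le> y" "y < m"
    and K: "K \<subseteq> {i. i < m \<and> card {j. (i, j) \<in> S} \<le> 1}"
    and card: "3 \<le> card (K - {x, y}) \<or> x = y \<and> 3 \<le> card K"
  shows "\<exists>L\<in>containing_two_columns. L \<noteq> {} \<and> L \<subseteq> pverts T \<and> L \<inter> S = {}"
proof -
  have finK: "finite K" using finite_subset[OF K] by simp
  let ?A = "{Suc x..<y}" and ?B = "{k. k < m \<and> (k < x \<or> y < k)}"
  have "\<exists>a b. a \<in> K \<and> b \<in> K \<and> a \<noteq> b \<and> (a \<in> ?A \<and> b \<in> ?A \<or> a \<in> ?B \<and> b \<in> ?B)"
  proof (cases "3 \<le> card (K - {x, y})")
    case True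
    have "?A \<inter> ?B = {}" "K - {x, y} \<subseteq> ?A \<union> ?B" using K by auto
    then obtain a b where "a \<in> K - {x, y}" "b \<in> K - {x, y}" "a \<noteq> b" "a \<in> ?A \<and> b \<in> ?A \<or> a \<in> ?B \<and> b \<in> ?B"
      using two_in_same_part[of ?A ?B "K - {x, y}"] True finK by blast
    then show ?thesis by blast
  next
    case False
    \<comment> \<open>A single cutting point leaves one arc, \<open>?B\<close>, which loses at most
      one of the three columns.\<close>
    then have "x = y" "3 \<le> card K" using card by blast+
    moreover have "card K - card {x} \<le> card (K - {x})" by (rule diff_card_le_card_Diff) simp
    moreover have "card {x} = 1" by simp
    ultimately have "2 \<le> card (K - {x})" by linarith
    then obtain a b where "a \<in> K - {x}" "b \<in> K - {x}" "a \<noteq> b"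
      using card_le_Suc0_iff_eq[OF finite_Diff[OF finK, of "{x}"]] by force
    moreover have "K - {x} \<subseteq> ?B" using K \<open>x = y\<close> by auto
    ultimately show ?thesis by blast
  qed
  then obtain a b where ab: "a \<in> K" "b \<in> K" "a \<noteq> b" "a \<in> ?A \<and> b \<in> ?A \<or> a \<in> ?B \<and> b \<in> ?B"
    by blast
  have *: ?thesis if R: "linked T ((\<lambda>i. (i, j)) ` R)" "R \<subseteq> {..<m} - {x, y}" "a \<in> R" "b \<in> R" for R
  proof (rule containing_two_columnsI[OF S R(1)])
    show "(\<lambda>i. (i, j)) ` R \<subseteq> pverts T" "(\<lambda>i. (i, j)) ` R \<inter> S = {}"
      using R(2) j by (auto simp: pverts_toroidal_grid)
    show "(a, j) \<in> (\<lambda>i. (i, j)) ` R" "(b, j) \<in> (\<lambda>i. (i, j)) ` R" using R by auto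
    show "a < m" "b < m" "a \<noteq> b" "card {j. (a, j) \<in> S} \<le> 1" "card {j. (b, j) \<in> S} \<le> 1"
      using ab K by auto
  qed
  from ab(4) show ?thesis
  proof
    assume "a \<in> ?A \<and> b \<in> ?A"
    then have "a \<in> ?A" "b \<in> ?A" by blast+
    moreover have "?A \<subseteq> {..<m} - {x, y}" using j(4) by fastforce
    moreover have "linked T ((\<lambda>i. (i, j)) ` ?A)" using linked_row_segment[OF j(1)] j(4) by simp
    ultimately show ?thesis by (intro *[of ?A])
  next
    assume "a \<in> ?B \<and> b \<in> ?B"
    then have "a \<in> ?B" "b \<in> ?B" by blast+
    moreover have "?B \<subseteq> {..<m} - {x, y}" using j(3) by fastforce
    ultimately show ?thesis using linked_row_arc[OF j(1)] by (intro *[of ?B])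
  qed
qed

text \<open>Fewer than \<open>2 * n\<close> vertices leave a row met at most once. If no column is
  free, at least \<open>2 * m - (2 * n - 1)\<close>, hence three, columns are met once, and two of
  them lie on the arc that remains of this row.\<close>

lemma treewidth_ge_2n_minus_1:
  assumes "n < m"
  shows "2 * int n - 1 \<le> treewidth T"
proof -
  have "int (2 * n - 1) \<le> treewidth T"
  proof (rule treewidth_ge[OF pair_graph_T, of _ containing_two_columns])
    fix S assume S: "S \<subseteq> pverts T" "card S \<le> 2 * n - 1"
    show "\<exists>L\<in>containing_two_columns. L \<noteq> {} \<and> L \<subseteq> pverts T \<and> L \<inter> S = {}"
    proof (cases "\<exists>i<m. card {j. (i, j) \<in> S} = 0")
      case True
      then show ?thesis using containing_two_columns_full[OF S(1)] by blast
    next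
      case False
      obtain j where j: "j < n" "card {i. (i, j) \<in> S} \<le> 1"
        using near_free_row[OF S(1)] S(2) n by fastforce
      obtain x where x: "{i. (i, j) \<in> S} \<subseteq> {x, x}" "x < m"
        using row_section_singleton[OF S(1) j(2)] .
      have "2 * m \<le> card S + card {i. i < m \<and> card {j. (i, j) \<in> S} = 1}"
        by (rule column_ones[OF S(1)]) (use False in auto)
      then have "3 \<le> card {i. i < m \<and> card {j. (i, j) \<in> S} = 1}" using assms S(2) n by linarith
      moreover have "{i. i < m \<and> card {j. (i, j) \<in> S} = 1} \<subseteq> {i. i < m \<and> card {j. (i, j) \<in> S} \<le> 1}"
        by auto
      ultimately show ?thesis
        using containing_two_columns_avoid[OF S(1) j(1) x(1) order_refl x(2)] by simp
    qed
  next
    show "\<exists>C. linked T C \<and> L \<union> L' \<subseteq> C \<and> C \<inter> X = {}"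
      if "X \<subseteq> pverts T" "card X < 2 * n - 1" "L \<in> containing_two_columns" "L' \<in> containing_two_columns"
        "L \<inter> X = {}" "L' \<inter> X = {}" for X L L'
      using containing_two_columns_joined[of X L L'] that unfolding joined_def by simp
  qed
  then show ?thesis using n by simp
qed

text \<open>Double counting: the columns in \<open>K\<close> contain \<open>card K\<close> vertices
  of \<open>S\<close> altogether, too few for \<open>N\<close> in each of the \<open>n\<close>
  rows.\<close>

lemma row_few_hits:
  assumes S: "S \<subseteq> pverts T" and K: "finite K" "\<And>i. i \<in> K \<Longrightarrow> card {j. (i, j) \<in> S} = 1"
    and "card K < N * n"
  shows "\<exists>j<n. card {i \<in> K. (i, j) \<in> S} < N"
proof (rule ccontr)
  assume "\<not> ?thesis"
  then have "N * n \<le> (\<Sum>j<n. card {i \<in> K. (i, j) \<in> S})"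
    using sum_bounded_below[of "{..<n}" N "\<lambda>j. card {i \<in> K. (i, j) \<in> S}"]
    by (simp add: mult.commute not_less) (meson not_le)
  also have "\<dots> = card (SIGMA j:{..<n}. {i \<in> K. (i, j) \<in> S})" using K(1) by simp
  also have "(SIGMA j:{..<n}. {i \<in> K. (i, j) \<in> S}) = prod.swap ` (SIGMA i:K. {j. (i, j) \<in> S})"
    using S by (force simp: pverts_toroidal_grid)
  also have "card \<dots> = card (SIGMA i:K. {j. (i, j) \<in> S})" by (simp add: card_image)
  also have "\<dots> = (\<Sum>i\<in>K. card {j. (i, j) \<in> S})" using K(1) finite_column_section[OF S] by simp
  also have "\<dots> = card K" using K(2) by simp
  finally show False using assms(4) by simp
qed

text \<open>If no column is free, \<open>2 * m - 2 * n \<ge> 4\<close> columns are met once. When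
  every row is met at least twice, each is met exactly twice, and since \<open>4 < 2 * n\<close>
  some row has at most one of its hits in those four columns. The other three lie on its two arcs,
  so two of them share an arc.\<close>

lemma treewidth_ge_2n:
  assumes "n + 2 \<le> m"
  shows "2 * int n \<le> treewidth T"
proof -
  have "int (2 * n) \<le> treewidth T"
  proof (rule treewidth_ge[OF pair_graph_T, of _ containing_two_columns])
    fix S assume S: "S \<subseteq> pverts T" "card S \<le> 2 * n"
    show "\<exists>L\<in>containing_two_columns. L \<noteq> {} \<and> L \<subseteq> pverts T \<and> L \<inter> S = {}"
    proof (cases "\<exists>i<m. card {j. (i, j) \<in> S} = 0")
      case True
      then show ?thesis using containing_two_columns_full[OF S(1)] by blast
    next
      case False
      have "2 * m \<le> card S + card {i. i < m \<and> card {j. (i, j) \<in> S} = 1}"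
        by (rule column_ones[OF S(1)]) (use False in auto)
      then have "4 \<le> card {i. i < m \<and> card {j. (i, j) \<in> S} = 1}" using assms S(2) n by linarith
      then obtain K where K: "K \<subseteq> {i. i < m \<and> card {j. (i, j) \<in> S} = 1}" "card K = 4" "finite K"
        by (rule obtain_subset_with_card_n)
      have "\<exists>j<n. \<exists>x y. {i. (i, j) \<in> S} \<subseteq> {x, y} \<and> x \<le> y \<and> y < m \<and> 3 \<le> card (K - {x, y})"
      proof (cases "\<exists>j<n. card {i. (i, j) \<in> S} \<le> 1")
        case True
        then obtain j where j: "j < n" "card {i. (i, j) \<in> S} \<le> 1" by (elim exE conjE)
        obtain x where "{i. (i, j) \<in> S} \<subseteq> {x, x}" "x < m"
          using row_section_singleton[OF S(1) j(2)] .
        moreover have "3 \<le> card (K - {x, x})"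
          using K(2) diff_card_le_card_Diff[of "{x}" K] by (simp del: card_Diff_insert)
        ultimately show ?thesis using j(1) by blast
      next
        case rows: False
        have two: "card {i. (i, j) \<in> S} = 2" if "j < n" for j
        proof (rule ccontr)
          assume "card {i. (i, j) \<in> S} \<noteq> 2"
          then have "2 < card {i. (i, j) \<in> S}" using rows that by force
          then have "(\<Sum>j<n. 2) < (\<Sum>j<n. card {i. (i, j) \<in> S})"
            using rows that by (intro sum_strict_mono_ex1) (auto simp: not_le Suc_le_eq)
          then show False using S(2) sum_rows[OF S(1)] by simp
        qed
        have "card K < 2 * n" using K(2) n by simp
        then obtain j where j: "j < n" "card {i \<in> K. (i, j) \<in> S} < 2"
          using row_few_hits[OF S(1) K(3)] K(1) by blast
        obtain a b where "{i. (i, j) \<in> S} = {a, b}" "a \<noteq> b"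
          using two[OF j(1)] unfolding card_2_iff by blast
        then have ab: "{i. (i, j) \<in> S} = {min a b, max a b}" "min a b < max a b"
          by (auto simp: min_def max_def)
        obtain x y where xy: "{i. (i, j) \<in> S} = {x, y}" "x < y" using ab by (rule that)
        have "y < m" using xy S(1) by (auto simp: pverts_toroidal_grid)
        have "{i \<in> K. (i, j) \<in> S} = K \<inter> {x, y}" using xy(1) by auto
        then have "card (K \<inter> {x, y}) < 2" using j(2) by simp
        moreover have "card (K - {x, y}) = card K - card (K \<inter> {x, y})"
          using K(3) by (simp add: card_Diff_subset_Int)
        ultimately have "3 \<le> card (K - {x, y})" using K(2) by simp
        moreover have "{i. (i, j) \<in> S} \<subseteq> {x, y}" "x \<le> y" using xy by simp_all
        ultimately show ?thesis using j(1) \<open>y < m\<close> by blast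
      qed
      then obtain j x y where "j < n" "{i. (i, j) \<in> S} \<subseteq> {x, y}" "x \<le> y" "y < m" "3 \<le> card (K - {x, y})"
        by blast
      then show ?thesis
        using containing_two_columns_avoid[OF S(1), of j x y K] K(1) by (auto simp: subset_iff)
    qed
  next
    show "\<exists>C. linked T C \<and> L \<union> L' \<subseteq> C \<and> C \<inter> X = {}"
      if "X \<subseteq> pverts T" "card X < 2 * n" "L \<in> containing_two_columns" "L' \<in> containing_two_columns"
        "L \<inter> X = {}" "L' \<inter> X = {}" for X L L'
      using containing_two_columns_joined[of X L L'] that unfolding joined_def by simp
  qed
  then show ?thesis by simp
qed

end

section \<open>The lower bound 5 for the \<open>3 \<times> 3\<close> torus\<close>

lemma treewidth_toroidal_grid_3_3_ge: "5 \<le> treewidth (toroidal_grid 3 3)"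
proof -
  interpret torus 3 3 by unfold_locales auto
  have adj: "y = Suc x mod 3 \<or> x = Suc y mod 3 \<or> x = y" if "x < 3" "y < 3" for x y :: nat
  proof -
    have "x = 0 \<or> x = 1 \<or> x = 2" "y = 0 \<or> y = 1 \<or> y = 2" using that by auto
    then show ?thesis by auto
  qed
  have "int 5 \<le> treewidth T"
  proof (rule treewidth_ge[OF pair_graph_T, of _ containing_column])
    show "\<exists>L\<in>containing_column. L \<noteq> {} \<and> L \<subseteq> pverts T \<and> L \<inter> S = {}"
      if "S \<subseteq> pverts T" "card S \<le> 5" for S
      using containing_column_avoid that by simp
  next
    fix X L L' assume X: "X \<subseteq> pverts T" "card X < 5"
      and L: "L \<in> containing_column" "L' \<in> containing_column" "L \<inter> X = {}" "L' \<inter> X = {}"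
    obtain i p where i: "linked T L" "i < 3" "col i p \<subseteq> L"
      using L by (auto simp: containing_column_def)
    obtain i' p' where i': "linked T L'" "i' < 3" "col i' p' \<subseteq> L'"
      using L by (auto simp: containing_column_def)
    \<comment> \<open>Four vertices in \<open>X\<close> guarantee only two rows met once, too few
      for one row to dodge both \<open>p\<close> and \<open>p'\<close>. Hence each member gets a row
      of its own.\<close>
    have "\<exists>j<3. \<exists>j'<3. \<exists>q q'. row j q \<inter> X = {} \<and> row j' q' \<inter> X = {} \<and>
        (i \<noteq> q \<or> j \<noteq> p) \<and> (i' \<noteq> q' \<or> j' \<noteq> p')"
    proof (cases "\<exists>j<3. card {i. (i, j) \<in> X} = 0")
      case True
      then obtain j where j: "j < 3" "card {i. (i, j) \<in> X} = 0" by (elim exE conjE)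
      then have "row j 3 \<inter> X = {}" using full_row_avoid[OF X(1)] by blast
      then show ?thesis using j(1) i(2) i'(2) by (metis less_irrefl)
    next
      case False
      let ?J = "{j. j < 3 \<and> card {i. (i, j) \<in> X} = 1}"
      have "2 * 3 \<le> card X + card ?J"
        by (rule row_ones[OF X(1)]) (use False in auto)
      then have J: "2 \<le> card ?J" using X(2) by linarith
      have *: "\<exists>j\<in>?J. j \<noteq> p" for p
      proof (rule ccontr)
        assume "\<not> ?thesis"
        then have "?J \<subseteq> {p}" by blast
        then have "card ?J \<le> card {p}" by (intro card_mono) auto
        then show False using J by simp
      qed
      have **: "\<exists>q. row j q \<inter> X = {}" if "j \<in> ?J" for j
        using row_avoid[OF X(1), of j] that by (metis (mono_tags, lifting) mem_Collect_eq order_refl)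
      obtain j where j: "j \<in> ?J" "j \<noteq> p" using *[of p] by blast
      obtain j' where j': "j' \<in> ?J" "j' \<noteq> p'" using *[of p'] by blast
      obtain q where "row j q \<inter> X = {}" using **[OF j(1)] by blast
      moreover obtain q' where "row j' q' \<inter> X = {}" using **[OF j'(1)] by blast
      ultimately show ?thesis using j j' by blast
    qed
    then obtain j j' q q' where q: "j < 3" "j' < 3" "row j q \<inter> X = {}" "row j' q' \<inter> X = {}"
      and "i \<noteq> q \<or> j \<noteq> p" "i' \<noteq> q' \<or> j' \<noteq> p'" by (elim exE conjE)
    then have 1: "joined T X L (row j q)" "joined T X (row j' q') L'"
      using joined_row[OF i(1) L(3) i(3) q(3) i(2) q(1)] joined_row[OF i'(1) L(4) i'(3) q(4) i'(2) q(2)]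
        joined_sym by blast+
    \<comment> \<open>Some column \<open>k\<close> is omitted by neither row, and on a cycle of
      length three its vertices in rows \<open>j\<close> and \<open>j'\<close> are equal or
      adjacent.\<close>
    have "\<not> {..<3} \<subseteq> {q, q'}"
    proof
      assume "{..<3::nat} \<subseteq> {q, q'}"
      then have "card {..<3::nat} \<le> card {q, q'}" by (intro card_mono) auto
      then show False by (auto simp: card_insert_if split: if_splits)
    qed
    then obtain k where k: "k < 3" "k \<noteq> q" "k \<noteq> q'" by blast
    then have "(k, j) \<in> row j q" "(k, j') \<in> row j' q'" by (auto simp: row_without_def)
    moreover have "(k, j) = (k, j') \<or> ((k, j), (k, j')) \<in> parcs T"
      using adj[OF q(1,2)] k(1) q(1,2) by (auto simp: parcs_toroidal_grid)
    ultimately have "joined T X (row j q) (row j' q')"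
      using q by (intro joined_touching sym_T linked_row) blast+
    then show "\<exists>C. linked T C \<and> L \<union> L' \<subseteq> C \<and> C \<inter> X = {}"
      using joined_trans[OF sym_T joined_trans[OF sym_T 1(1)] 1(2)] row_nonempty
      unfolding joined_def by blast
  qed
  then show ?thesis by simp
qed

section \<open>Upper bounds\<close>

text \<open>A path decomposition in which \<open>v\<close> is present from time \<open>s v\<close>
  to \<open>e v\<close>. As arcs come in both directions, \<open>edge\<close> makes the intervals of
  adjacent vertices meet, namely at the later of the two starts.\<close>

lemma treewidth_le_intervals:
  fixes s e :: "'a \<Rightarrow> nat" and k :: nat
  assumes G: "pair_graph G"
    and se: "\<And>v. v \<in> pverts G \<Longrightarrow> s v \<le> e v"
    and edge: "\<And>u v. (u, v) \<in> parcs G \<Longrightarrow> s u \<le> e v"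
    and card: "\<And>t. card {v \<in> pverts G. s v \<le> t \<and> t \<le> e v} \<le> k + 1"
  shows "treewidth G \<le> int k"
proof -
  interpret G: pair_graph G by fact
  define W where "W t = {v \<in> pverts G. s v \<le> t \<and> t \<le> e v}" for t
  define N where "N = Suc (Max (insert 0 (e ` pverts G)))"
  have fin: "finite (insert 0 (e ` pverts G))" using G.pair_finite_verts by simp
  have N: "e v < N" if "v \<in> pverts G" for v
    unfolding N_def less_Suc_eq_le by (rule Max_ge[OF fin]) (use that in simp)
  have "rooted_decomposition G N (\<lambda>i. i - 1) W"
    unfolding rooted_decomposition_def
  proof (intro conjI)
    show "0 < N" by (simp add: N_def)
    show "(\<Union>i<N. W i) = pverts G"
    proof
      show "pverts G \<subseteq> (\<Union>i<N. W i)"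
      proof
        fix v assume v: "v \<in> pverts G"
        then have "v \<in> W (e v)" using se by (simp add: W_def)
        then show "v \<in> (\<Union>i<N. W i)" using N[OF v] by blast
      qed
    qed (auto simp: W_def)
    show "\<forall>(u, v)\<in>parcs G. \<exists>i<N. u \<in> W i \<and> v \<in> W i"
    proof clarify
      fix u v assume uv: "(u, v) \<in> parcs G"
      then have V: "u \<in> pverts G" "v \<in> pverts G" by (auto dest: G.in_arcsD1 G.in_arcsD2)
      have "s u \<le> e v" "s v \<le> e u" using edge uv G.arcs_symmetric by blast+
      then have "u \<in> W (max (s u) (s v))" "v \<in> W (max (s u) (s v))"
        using V se[OF V(1)] se[OF V(2)] by (simp_all add: W_def)
      moreover have "max (s u) (s v) < N"
        using se[OF V(1)] se[OF V(2)] N[OF V(1)] N[OF V(2)] by simp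
      ultimately show "\<exists>i<N. u \<in> W i \<and> v \<in> W i" by blast
    qed
    show "\<forall>i<N. \<forall>j<i. W i \<inter> W j \<subseteq> W (i - 1)" by (auto simp: W_def)
  qed simp
  moreover have "int (card (W t)) \<le> int k + 1" for t
    using card[of t] unfolding W_def by linarith
  ultimately show ?thesis by (rule treewidth_le[OF G])
qed

text \<open>The vertex separation bound for a linear order: each vertex stays until its last
  neighbour arrives. The bag at \<open>t\<close> is the boundary of the initial segment before
  \<open>t\<close> together with at most one vertex at \<open>t\<close>.\<close>

lemma treewidth_le_layout:
  fixes f :: "'a \<Rightarrow> nat" and k :: nat
  assumes G: "pair_graph G" and inj: "inj_on f (pverts G)"
    and card: "\<And>t. card {u \<in> pverts G. f u < t \<and> (\<exists>w. (u, w) \<in> parcs G \<and> t \<le> f w)} \<le> k"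
  shows "treewidth G \<le> int k"
proof -
  interpret G: pair_graph G by fact
  define nbrs where "nbrs v = insert v {w. (v, w) \<in> parcs G}" for v
  have fin: "finite (f ` nbrs v)" if "v \<in> pverts G" for v
  proof -
    have "nbrs v \<subseteq> pverts G" using that by (auto simp: nbrs_def dest: G.in_arcsD2)
    then show ?thesis using G.pair_finite_verts by (meson finite_imageI finite_subset)
  qed
  define e where "e v = Max (f ` nbrs v)" for v
  have e: "f w \<le> e v" if "v \<in> pverts G" "w \<in> nbrs v" for v w
    unfolding e_def using fin[OF that(1)] that(2) by simp
  have attained: "\<exists>w\<in>nbrs v. e v = f w" if "v \<in> pverts G" for v
    using Max_in[OF fin[OF that]] unfolding e_def by (auto simp: nbrs_def)
  show ?thesis
  proof (rule treewidth_le_intervals[OF G, of f e])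
    show "f v \<le> e v" if "v \<in> pverts G" for v using e[OF that] by (simp add: nbrs_def)
    show "f u \<le> e v" if "(u, v) \<in> parcs G" for u v
      using e[OF G.in_arcsD2[OF that]] G.arcs_symmetric[OF that] by (simp add: nbrs_def)
    show "card {v \<in> pverts G. f v \<le> t \<and> t \<le> e v} \<le> k + 1" for t
    proof -
      let ?B = "{u \<in> pverts G. f u < t \<and> (\<exists>w. (u, w) \<in> parcs G \<and> t \<le> f w)}"
      let ?C = "{v \<in> pverts G. f v = t}"
      have "{v \<in> pverts G. f v \<le> t \<and> t \<le> e v} \<subseteq> ?B \<union> ?C"
      proof
        fix v assume "v \<in> {v \<in> pverts G. f v \<le> t \<and> t \<le> e v}"
        then have v: "v \<in> pverts G" "f v \<le> t" "t \<le> e v" by auto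
        obtain w where "w \<in> nbrs v" "e v = f w" using attained[OF v(1)] by blast
        then show "v \<in> ?B \<union> ?C" using v by (cases "f v = t") (auto simp: nbrs_def)
      qed
      moreover have "finite ?B" "finite ?C" using G.pair_finite_verts by simp_all
      ultimately have "card {v \<in> pverts G. f v \<le> t \<and> t \<le> e v} \<le> card ?B + card ?C"
        by (meson card_Un_le card_mono finite_UnI order_trans)
      moreover have "card ?C \<le> 1"
        using \<open>finite ?C\<close> inj card_le_Suc0_iff_eq[of ?C] by (auto simp: inj_on_def)
      ultimately show ?thesis using card[of t] by linarith
    qed
  qed
qed

text \<open>
  A window of \<open>n + 1\<close> consecutive vertices in lexicographic order sweeps the columns \<open>1, \<dots>, m - 1\<close>
  while column \<open>0\<close> is kept in every bag.
\<close>
lemma (in torus) treewidth_le_2n: "treewidth T \<le> 2 * int n"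
proof -
  \<comment> \<open>For \<open>a > 0\<close> the vertex has position \<open>(a - 1) * n + b\<close>,
    at which it leaves; it enters \<open>n\<close> positions earlier, since neighbours outside
    column 0 are at most \<open>n\<close> positions away. Truncation lets column 1 start at time
    0.\<close>
  define s where "s v = (case v of (a, b) \<Rightarrow> if a = 0 then 0 else (a - 1) * n + b - n)" for v
  define e where "e v = (case v of (a, b) \<Rightarrow> if a = 0 then m * n else (a - 1) * n + b)" for v
  have "treewidth T \<le> int (2 * n)"
  proof (rule treewidth_le_intervals[OF pair_graph_T, of s e])
    show "s v \<le> e v" if "v \<in> pverts T" for v by (auto simp: s_def e_def split: prod.split)
    show "s u \<le> e v" if uv: "(u, v) \<in> parcs T" for u v
    proof -
      obtain a b c d where u: "u = (a, b)" and v: "v = (c, d)" by (cases u; cases v)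
      have lt: "a < m" "b < n" "d < n"
        and adj: "b = d \<and> (c = Suc a mod m \<or> a = Suc c mod m) \<or> a = c"
        using uv m n by (auto simp: u v parcs_toroidal_grid)
      have "(a - 1) * n + b - n \<le> (a - 1) * n" using lt(2) by linarith
      then have s: "s u \<le> (a - 1) * n" by (simp add: s_def u)
      consider "a = 0" | "c = 0" | "0 < a" "0 < c" "a \<le> c" | "0 < a" "0 < c" "c < a" by linarith
      then show ?thesis
      proof cases
        case 2
        have "(a - 1) * n \<le> m * n" using lt by (intro mult_right_mono) auto
        then have "s u \<le> m * n" using s by linarith
        then show ?thesis using 2 by (simp add: e_def v)
      next
        case 3
        have "(a - 1) * n \<le> (c - 1) * n" using 3 by (intro mult_right_mono) auto
        then have "s u \<le> (c - 1) * n + d" using s by linarith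
        then show ?thesis using 3 by (simp add: e_def v)
      next
        case 4
        then have "b = d" "a = Suc c" using adj lt by (auto simp: mod_Suc split: if_splits)
        then show ?thesis using 4 by (cases c) (auto simp: s_def e_def u v)
      qed (simp add: s_def u)
    qed
    show "card {v \<in> pverts T. s v \<le> t \<and> t \<le> e v} \<le> 2 * n + 1" for t
    proof -
      \<comment> \<open>\<open>?B\<close> turns the positions of the window back into coordinates;
        \<open>Suc\<close> accounts for column 0, which has no positions.\<close>
      let ?A = "Pair (0::nat) ` {..<n}" and ?B = "(\<lambda>x. (Suc (x div n), x mod n)) ` {t..t + n}"
      have "{v \<in> pverts T. s v \<le> t \<and> t \<le> e v} \<subseteq> ?A \<union> ?B"
      proof
        fix v assume "v \<in> {v \<in> pverts T. s v \<le> t \<and> t \<le> e v}"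
        then obtain a b where v: "v = (a, b)" "a < m" "b < n" "s (a, b) \<le> t" "t \<le> e (a, b)"
          by (auto simp: pverts_toroidal_grid)
        show "v \<in> ?A \<union> ?B"
        proof (cases a)
          case (Suc a')
          let ?x = "a' * n + b"
          have "?x \<in> {t..t + n}" using v(4,5) Suc by (simp add: s_def e_def)
          moreover have "v = (Suc (?x div n), ?x mod n)" using v Suc by simp
          ultimately show ?thesis by blast
        qed (use v in simp)
      qed
      then have "card {v \<in> pverts T. s v \<le> t \<and> t \<le> e v} \<le> card (?A \<union> ?B)"
        by (intro card_mono) auto
      also have "\<dots> \<le> card ?A + card ?B" by (rule card_Un_le)
      also have "\<dots> \<le> n + Suc n"
        using card_image_le[of "{..<n}" "Pair (0::nat)"] card_image_le[of "{t..t + n}" "\<lambda>x. (Suc (x div n), x mod n)"]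
        by (intro add_mono) auto
      finally show ?thesis by simp
    qed
  qed
  then show ?thesis by simp
qed

section \<open>A diamond-shaped order on the square torus\<close>

definition cyclic_abs :: "nat \<Rightarrow> nat \<Rightarrow> nat" where
  "cyclic_abs n i = min i (n - i)"

text \<open>A number written with three digits, compared lexicographically. The test separates
  levels up to \<open>n div 2\<close> from those above. In the lower half smaller distances of
  \<open>i\<close> from 0 come first, in the upper half larger ones. The two bits are sides of the
  cycle, led by the side of the coordinate that varies when the boundary is counted.\<close>

definition diamond_tie :: "nat \<Rightarrow> nat \<Rightarrow> nat \<Rightarrow> nat" where
  "diamond_tie n i j =
     (if cyclic_abs n i \<le> cyclic_abs n j
      then 4 * cyclic_abs n i + 2 * of_bool (i \<le> n div 2) + of_bool (j \<le> n div 2)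
      else 4 * (n div 2 - cyclic_abs n i) + 2 * of_bool (j \<le> n div 2) + of_bool (i \<le> n div 2))"

text \<open>
  The level \<open>n div 2 + \<bar>i\<bar> - \<bar>j\<bar>\<close> is the distance to the vertex \<open>(0, n div 2)\<close>, up to parity effects.
  Up to level \<open>n div 2\<close> the boundary of an initial segment is counted by columns, from then on by
  rows; ties are broken accordingly.
\<close>
definition diamond_key :: "nat \<Rightarrow> nat \<times> nat \<Rightarrow> nat" where
  "diamond_key n v = (case v of (i, j) \<Rightarrow>
     (n div 2 + cyclic_abs n i - cyclic_abs n j) * (4 * Suc (n div 2)) + diamond_tie n i j)"

lemma cyclic_abs_le: "cyclic_abs n i \<le> n div 2"
  by (auto simp: cyclic_abs_def min_def)

text \<open>\<open>cyclic_abs\<close> is the distance from 0 on the cycle, and together with the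
  side it determines the vertex.\<close>

lemma cyclic_abs_inj:
  assumes "i < n" "i' < n" "i \<le> n div 2 \<longleftrightarrow> i' \<le> n div 2" "cyclic_abs n i = cyclic_abs n i'"
  shows "i = i'"
  using assms by (auto simp: cyclic_abs_def min_def split: if_splits)

lemma cyclic_abs_eq_0: "i < n \<Longrightarrow> cyclic_abs n i = 0 \<longleftrightarrow> i = 0"
  by (auto simp: cyclic_abs_def min_def)

lemma cyclic_abs_adjacent:
  assumes "i < n" "i' < n" "i' = Suc i mod n \<or> i = Suc i' mod n"
  shows "cyclic_abs n i \<le> Suc (cyclic_abs n i')"
  using assms by (auto simp: cyclic_abs_def min_def mod_Suc split: if_splits)

text \<open>A step between the sides happens only at 0 or at the antipode. The upper side has no
  vertex at distance 0; at the antipode an \<open>i2\<close> as required exists only for odd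
  \<open>n\<close>, and then it is \<open>i\<close> itself.\<close>

lemma cyclic_abs_cross:
  assumes "i < n" "i' < n" "i2 < n" "i' = Suc i mod n \<or> i = Suc i' mod n"
    and "n div 2 < i" "n div 2 < i2" "i' \<le> n div 2"
    and "cyclic_abs n i' = cyclic_abs n i2"
  shows "cyclic_abs n i2 \<noteq> Suc (cyclic_abs n i)" "cyclic_abs n i \<noteq> Suc (cyclic_abs n i2)"
  using assms by (auto simp: cyclic_abs_def min_def mod_Suc split: if_splits)

text \<open>The tie is at most \<open>4 * (n div 2) + 3\<close>, so division by
  \<open>4 * Suc (n div 2)\<close> recovers the level from the key, and the remainder is the
  tie.\<close>

lemma diamond_tie_less: "diamond_tie n i j < 4 * Suc (n div 2)"
  using cyclic_abs_le[of n i] by (auto simp: diamond_tie_def)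

lemma diamond_key_div:
  "diamond_key n (i, j) div (4 * Suc (n div 2)) = n div 2 + cyclic_abs n i - cyclic_abs n j"
proof -
  let ?K = "4 * Suc (n div 2)"
  have "(x * ?K + diamond_tie n i j) div ?K = x" for x
    using diamond_tie_less[of n i j] by (simp only: div_mult_self3 div_less add_0_right)
  then show ?thesis by (simp only: diamond_key_def prod.case)
qed

lemma diamond_key_mod: "diamond_key n (i, j) mod (4 * Suc (n div 2)) = diamond_tie n i j"
  using diamond_tie_less[of n i j] by (simp only: diamond_key_def prod.case mod_mult_self3 mod_less)

lemma diamond_key_less:
  assumes "diamond_key n (i, j) < diamond_key n (i', j')"
    and "n div 2 + cyclic_abs n i - cyclic_abs n j = n div 2 + cyclic_abs n i' - cyclic_abs n j'"
  shows "diamond_tie n i j < diamond_tie n i' j'"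
  using assms by (simp add: diamond_key_def)

lemma digits_eq:
  fixes a a' :: nat
  shows "4 * a + 2 * of_bool p + of_bool q = 4 * a' + 2 * of_bool p' + of_bool q' \<longleftrightarrow>
    a = a' \<and> p = p' \<and> q = q'"
  by (cases p; cases q; cases p'; cases q'; simp; presburger)

lemma digits_less:
  fixes a a' :: nat
  assumes "4 * a + 2 * of_bool p + of_bool q < 4 * a' + 2 * of_bool p' + of_bool q'"
  shows "a \<le> a'" "a = a' \<Longrightarrow> q = q' \<Longrightarrow> \<not> p \<and> p'"
  using assms by (cases p; cases q; cases p'; cases q'; simp)+

lemma inj_on_diamond_key: "inj_on (diamond_key n) ({..<n} \<times> {..<n})"
proof (rule inj_onI, clarify)
  fix i j i' j' assume lt: "i < n" "j < n" "i' < n" "j' < n"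
    and eq: "diamond_key n (i, j) = diamond_key n (i', j')"
  have 1: "n div 2 + cyclic_abs n i - cyclic_abs n j = n div 2 + cyclic_abs n i' - cyclic_abs n j'"
    using eq diamond_key_div by metis
  have 2: "diamond_tie n i j = diamond_tie n i' j'" using eq diamond_key_mod by metis
  note le = cyclic_abs_le[of n i] cyclic_abs_le[of n j] cyclic_abs_le[of n i'] cyclic_abs_le[of n j']
  have iff: "cyclic_abs n i \<le> cyclic_abs n j \<longleftrightarrow> cyclic_abs n i' \<le> cyclic_abs n j'"
    using 1 le by linarith
  have i: "cyclic_abs n i = cyclic_abs n i' \<and> (i \<le> n div 2 \<longleftrightarrow> i' \<le> n div 2) \<and> (j \<le> n div 2 \<longleftrightarrow> j' \<le> n div 2)"
    using 2 iff le by (auto simp: diamond_tie_def digits_eq split: if_splits; linarith)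
  then have "cyclic_abs n j = cyclic_abs n j'" using 1 le by linarith
  then show "i = i' \<and> j = j'" using cyclic_abs_inj i lt by metis
qed

text \<open>The neighbour \<open>(iw, jw)\<close> has at least the level of \<open>(i2, j)\<close>,
  which exceeds that of \<open>(i1, j)\<close>. A step changes the level by at most one, so the
  levels agree and the tie decides. Its first digit forces a step from \<open>i1\<close> to an
  \<open>iw\<close> as far from 0 as \<open>i2\<close>, and its side bit puts \<open>iw\<close> on
  the other side, which \<open>cyclic_abs_cross\<close> excludes.\<close>

lemma boundary_same_column:
  assumes lt: "i1 < n" "i2 < n" "j < n" "iw < n" "jw < n"
    and side: "i1 \<le> n div 2 \<longleftrightarrow> i2 \<le> n div 2" and less: "cyclic_abs n i1 < cyclic_abs n i2"
    and adj: "jw = j \<and> (iw = Suc i1 mod n \<or> i1 = Suc iw mod n) \<or>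
      iw = i1 \<and> (jw = Suc j mod n \<or> j = Suc jw mod n)"
    and t: "diamond_key n (i2, j) < t" "t \<le> diamond_key n (iw, jw)"
    and level: "t div (4 * Suc (n div 2)) \<le> n div 2"
  shows False
proof -
  let ?c = "cyclic_abs n" and ?h = "n div 2"
  note le = cyclic_abs_le[of n i1] cyclic_abs_le[of n i2] cyclic_abs_le[of n iw]
    cyclic_abs_le[of n j] cyclic_abs_le[of n jw]
  have 1: "?h + ?c i2 - ?c j \<le> ?h"
    using div_le_mono[OF less_imp_le[OF t(1)], of "4 * Suc ?h"] level unfolding diamond_key_div by linarith
  have 2: "?h + ?c i2 - ?c j \<le> ?h + ?c iw - ?c jw"
    using div_le_mono[of "diamond_key n (i2, j)" "diamond_key n (iw, jw)" "4 * Suc ?h"] t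
    unfolding diamond_key_div by linarith
  have step: "?c iw \<le> Suc (?c i1) \<and> jw = j \<or> iw = i1 \<and> ?c j \<le> Suc (?c jw)"
    using adj cyclic_abs_adjacent lt by metis
  have "?c iw \<le> Suc (?c i1) \<and> ?c jw = ?c j \<or> ?c iw = ?c i1 \<and> ?c j \<le> Suc (?c jw)" using step by auto
  then have eq: "?h + ?c i2 - ?c j = ?h + ?c iw - ?c jw" using 2 less le by linarith
  have "diamond_tie n i2 j < diamond_tie n iw jw"
    using diamond_key_less[OF _ eq] t by simp
  moreover have "?c i2 \<le> ?c j" "?c iw \<le> ?c jw" using 1 eq le by linarith+
  ultimately have dig: "4 * ?c i2 + 2 * of_bool (i2 \<le> ?h) + of_bool (j \<le> ?h)
      < 4 * ?c iw + 2 * of_bool (iw \<le> ?h) + (of_bool (jw \<le> ?h) :: nat)"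
    by (simp add: diamond_tie_def)
  then have "?c i2 \<le> ?c iw" by (rule digits_less)
  then have w: "jw = j" "?c iw = Suc (?c i1)" "?c iw = ?c i2" using step less by auto
  then have "\<not> i2 \<le> ?h \<and> iw \<le> ?h" using digits_less(2)[OF dig] by simp
  then show False
    using cyclic_abs_cross(1)[of i1 n iw i2] lt side adj w less by auto
qed

text \<open>The mirror image of \<open>boundary_same_column\<close>. The level falls with the
  distance of \<open>j\<close> from 0, and the first digit \<open>n div 2 - cyclic_abs n i\<close>
  now rules out a step that changes \<open>i\<close>.\<close>

lemma boundary_same_row:
  assumes lt: "i < n" "j1 < n" "j2 < n" "iw < n" "jw < n"
    and side: "j1 \<le> n div 2 \<longleftrightarrow> j2 \<le> n div 2" and less: "cyclic_abs n j2 < cyclic_abs n j1"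
    and adj: "jw = j1 \<and> (iw = Suc i mod n \<or> i = Suc iw mod n) \<or>
      iw = i \<and> (jw = Suc j1 mod n \<or> j1 = Suc jw mod n)"
    and t: "diamond_key n (i, j2) < t" "t \<le> diamond_key n (iw, jw)"
    and level: "n div 2 < t div (4 * Suc (n div 2))"
  shows False
proof -
  let ?c = "cyclic_abs n" and ?h = "n div 2"
  note le = cyclic_abs_le[of n i] cyclic_abs_le[of n j1] cyclic_abs_le[of n j2] cyclic_abs_le[of n iw]
    cyclic_abs_le[of n jw]
  have 1: "?h < ?h + ?c iw - ?c jw"
    using div_le_mono[OF t(2), of "4 * Suc ?h"] level unfolding diamond_key_div by linarith
  have 2: "?h + ?c i - ?c j2 \<le> ?h + ?c iw - ?c jw"
    using div_le_mono[of "diamond_key n (i, j2)" "diamond_key n (iw, jw)" "4 * Suc ?h"] t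
    unfolding diamond_key_div by linarith
  have step: "?c iw \<le> Suc (?c i) \<and> jw = j1 \<or> iw = i \<and> ?c j1 \<le> Suc (?c jw)"
    using adj cyclic_abs_adjacent lt by metis
  have "?c iw \<le> Suc (?c i) \<and> ?c jw = ?c j1 \<or> ?c iw = ?c i \<and> ?c j1 \<le> Suc (?c jw)" using step by auto
  then have eq: "?h + ?c i - ?c j2 = ?h + ?c iw - ?c jw" using 2 less le by linarith
  have "diamond_tie n i j2 < diamond_tie n iw jw"
    using diamond_key_less[OF _ eq] t by simp
  moreover have "\<not> ?c i \<le> ?c j2" "\<not> ?c iw \<le> ?c jw" using 1 eq le by linarith+
  ultimately have dig: "4 * (?h - ?c i) + 2 * of_bool (j2 \<le> ?h) + of_bool (i \<le> ?h)
      < 4 * (?h - ?c iw) + 2 * of_bool (jw \<le> ?h) + (of_bool (iw \<le> ?h) :: nat)"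
    by (simp add: diamond_tie_def)
  then have "?h - ?c i \<le> ?h - ?c iw" by (rule digits_less)
  then have "?c iw \<le> ?c i" using le by linarith
  then have w: "iw = i" "?c j1 = Suc (?c jw)" "?c jw = ?c j2"
  proof -
    have "?c jw = ?c j2" if "iw = i" using eq le unfolding that by linarith
    then show "iw = i" "?c j1 = Suc (?c jw)" "?c jw = ?c j2"
      using step less eq le 1 \<open>?c iw \<le> ?c i\<close> by auto
  qed
  then have "\<not> j2 \<le> ?h \<and> jw \<le> ?h" using digits_less(2)[OF dig] by simp
  then show False
    using cyclic_abs_cross(2)[of j1 n jw j2] lt side adj w less by auto
qed

text \<open>A boundary vertex is coded by one coordinate and the side of the other. The two
  preceding lemmas make the code injective, and the code \<open>(0, False)\<close> never occurs,
  which saves one of the \<open>2 * n\<close> values.\<close>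

lemma diamond_boundary:
  assumes n: "3 \<le> n"
  shows "card {u \<in> pverts (toroidal_grid n n). diamond_key n u < t \<and>
    (\<exists>w. (u, w) \<in> parcs (toroidal_grid n n) \<and> t \<le> diamond_key n w)} \<le> 2 * n - 1" (is "card ?B \<le> _")
proof -
  let ?c = "cyclic_abs n" and ?h = "n div 2" and ?K = "4 * Suc (n div 2)"
  have B: "\<exists>iw jw. i < n \<and> j < n \<and> iw < n \<and> jw < n \<and> diamond_key n (i, j) < t \<and> t \<le> diamond_key n (iw, jw) \<and>
      (jw = j \<and> (iw = Suc i mod n \<or> i = Suc iw mod n) \<or>
       iw = i \<and> (jw = Suc j mod n \<or> j = Suc jw mod n))"
    if "(i, j) \<in> ?B" for i j
    using that n by (auto simp: pverts_toroidal_grid parcs_toroidal_grid)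
  have card: "card (({..<n} \<times> UNIV) - {(0, False)}) = 2 * n - 1"
    using n by (simp add: card_Diff_singleton_if card_cartesian_product)
  show ?thesis
  proof (cases "t div ?K \<le> ?h")
    case True
    let ?f = "\<lambda>(i, j). (j, i \<le> ?h)"
    have "inj_on ?f ?B"
    proof (rule inj_onI)
      fix u1 u2 assume B12: "u1 \<in> ?B" "u2 \<in> ?B" and eq: "?f u1 = ?f u2"
      obtain i j where u1: "u1 = (i, j)" by (cases u1)
      obtain i' where u2: "u2 = (i', j)" and side: "i \<le> ?h \<longleftrightarrow> i' \<le> ?h"
        using eq u1 by (cases u2) simp
      have u: "(i, j) \<in> ?B" "(i', j) \<in> ?B" using B12 u1 u2 by blast+
      show "u1 = u2"
      proof (rule ccontr)
        assume neq: "\<not> ?thesis"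
        from B[OF u(1)] obtain iw jw where 1: "i < n" "j < n" "iw < n" "jw < n"
          "diamond_key n (i, j) < t" "t \<le> diamond_key n (iw, jw)"
          "jw = j \<and> (iw = Suc i mod n \<or> i = Suc iw mod n) \<or>
           iw = i \<and> (jw = Suc j mod n \<or> j = Suc jw mod n)" by (elim exE conjE)
        from B[OF u(2)] obtain iw' jw' where 2: "i' < n" "j < n" "iw' < n" "jw' < n"
          "diamond_key n (i', j) < t" "t \<le> diamond_key n (iw', jw')"
          "jw' = j \<and> (iw' = Suc i' mod n \<or> i' = Suc iw' mod n) \<or>
           iw' = i' \<and> (jw' = Suc j mod n \<or> j = Suc jw' mod n)" by (elim exE conjE)
        have "?c i \<noteq> ?c i'" using cyclic_abs_inj[OF 1(1) 2(1) side] neq u1 u2 by blast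
        then consider "?c i < ?c i'" | "?c i' < ?c i" by linarith
        then show False
        proof cases
          case less: 1
          show ?thesis
            by (rule boundary_same_column[OF 1(1) 2(1) 1(2-4) side less 1(7) 2(5) 1(6) True])
        next
          case less: 2
          show ?thesis
            by (rule boundary_same_column[OF 2(1) 1(1) 2(2-4) side[symmetric] less 2(7) 1(5) 2(6) True])
        qed
      qed
    qed
    moreover have "?f ` ?B \<subseteq> ({..<n} \<times> UNIV) - {(0, False)}"
    proof (rule image_subsetI)
      fix u' assume u': "u' \<in> ?B"
      obtain i j where ij: "u' = (i, j)" by (cases u')
      have u: "(i, j) \<in> ?B" using u' unfolding ij .
      \<comment> \<open>A level of at most \<open>n div 2\<close> means that \<open>i\<close> is no
        farther from 0 than \<open>j\<close>, so \<open>j = 0\<close> forces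
        \<open>i = 0\<close>.\<close>
      have "i \<le> ?h" if "j = 0"
      proof -
        have w: "i < n" "diamond_key n (i, j) < t" using u by (simp_all add: pverts_toroidal_grid)
        have "?h + ?c i - ?c j \<le> ?h"
          using div_le_mono[OF less_imp_le[OF w(2)], of ?K] True unfolding diamond_key_div by linarith
        then have "?c i = 0" using \<open>j = 0\<close> by (simp add: cyclic_abs_def)
        then have "i = 0" using cyclic_abs_eq_0[OF w(1)] by simp
        then show ?thesis by simp
      qed
      moreover have "j < n" using u by (simp add: pverts_toroidal_grid)
      ultimately show "?f u' \<in> ({..<n} \<times> UNIV) - {(0, False)}" by (auto simp: ij)
    qed
    ultimately show ?thesis using card card_inj_on_le[of ?f ?B "({..<n} \<times> UNIV) - {(0, False)}"] by simp
  next
    case False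
    then have level: "?h < t div ?K" by linarith
    let ?f = "\<lambda>(i, j). (i, j \<le> ?h)"
    have "inj_on ?f ?B"
    proof (rule inj_onI)
      fix u1 u2 assume B12: "u1 \<in> ?B" "u2 \<in> ?B" and eq: "?f u1 = ?f u2"
      obtain i j where u1: "u1 = (i, j)" by (cases u1)
      obtain j' where u2: "u2 = (i, j')" and side: "j \<le> ?h \<longleftrightarrow> j' \<le> ?h"
        using eq u1 by (cases u2) simp
      have u: "(i, j) \<in> ?B" "(i, j') \<in> ?B" using B12 u1 u2 by blast+
      show "u1 = u2"
      proof (rule ccontr)
        assume neq: "\<not> ?thesis"
        from B[OF u(1)] obtain iw jw where 1: "i < n" "j < n" "iw < n" "jw < n"
          "diamond_key n (i, j) < t" "t \<le> diamond_key n (iw, jw)"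
          "jw = j \<and> (iw = Suc i mod n \<or> i = Suc iw mod n) \<or>
           iw = i \<and> (jw = Suc j mod n \<or> j = Suc jw mod n)" by (elim exE conjE)
        from B[OF u(2)] obtain iw' jw' where 2: "i < n" "j' < n" "iw' < n" "jw' < n"
          "diamond_key n (i, j') < t" "t \<le> diamond_key n (iw', jw')"
          "jw' = j' \<and> (iw' = Suc i mod n \<or> i = Suc iw' mod n) \<or>
           iw' = i \<and> (jw' = Suc j' mod n \<or> j' = Suc jw' mod n)" by (elim exE conjE)
        have "?c j \<noteq> ?c j'" using cyclic_abs_inj[OF 1(2) 2(2) side] neq u1 u2 by blast
        then consider "?c j' < ?c j" | "?c j < ?c j'" by linarith
        then show False
        proof cases
          case less: 1
          show ?thesis
            by (rule boundary_same_row[OF 1(1,2) 2(2) 1(3,4) side less 1(7) 2(5) 1(6) level])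
        next
          case less: 2
          show ?thesis
            by (rule boundary_same_row[OF 1(1) 2(2) 1(2) 2(3,4) side[symmetric] less 2(7) 1(5) 2(6) level])
        qed
      qed
    qed
    moreover have "?f ` ?B \<subseteq> ({..<n} \<times> UNIV) - {(0, False)}"
    proof (rule image_subsetI)
      fix u' assume u': "u' \<in> ?B"
      obtain i j where ij: "u' = (i, j)" by (cases u')
      have u: "(i, j) \<in> ?B" using u' unfolding ij .
      \<comment> \<open>The later neighbour decides: at a level above \<open>n div 2\<close>,
        \<open>iw\<close> is farther from 0 than \<open>jw\<close>, yet at distance at most 1. Thus
        \<open>jw = 0\<close>, the step changed the first coordinate, and
        \<open>j = 0\<close>.\<close>
      have "j \<le> ?h" if "i = 0"
      proof -
        obtain iw jw where w: "j < n" "iw < n" "jw < n" "t \<le> diamond_key n (iw, jw)"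
          "jw = j \<and> (iw = Suc i mod n \<or> i = Suc iw mod n) \<or>
           iw = i \<and> (jw = Suc j mod n \<or> j = Suc jw mod n)" using B[OF u] by (elim exE conjE)
        have "?h < ?h + ?c iw - ?c jw"
          using div_le_mono[OF w(4), of ?K] False unfolding diamond_key_div by linarith
        moreover have "?c iw \<le> Suc (?c i)" using w \<open>i = 0\<close> n cyclic_abs_adjacent[of iw n i] by auto
        moreover have "?c i = 0" using \<open>i = 0\<close> by (simp add: cyclic_abs_def)
        ultimately have "?c jw = 0" "iw \<noteq> i" by auto
        then have "j = 0" using w(5) cyclic_abs_eq_0[OF w(3)] by auto
        then show ?thesis by simp
      qed
      moreover have "i < n" using u by (simp add: pverts_toroidal_grid)
      ultimately show "?f u' \<in> ({..<n} \<times> UNIV) - {(0, False)}" by (auto simp: ij)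
    qed
    ultimately show ?thesis using card card_inj_on_le[of ?f ?B "({..<n} \<times> UNIV) - {(0, False)}"] by simp
  qed
qed

lemma treewidth_square_le:
  assumes "3 \<le> n"
  shows "treewidth (toroidal_grid n n) \<le> 2 * int n - 1"
proof -
  interpret torus n n using assms by unfold_locales
  have "treewidth T \<le> int (2 * n - 1)"
    using treewidth_le_layout[OF pair_graph_T, of "diamond_key n"] diamond_boundary[OF assms]
      inj_on_diamond_key[of n] by (simp add: pverts_toroidal_grid)
  then show ?thesis using assms by simp
qed

section \<open>Small tori\<close>

text \<open>A certificate check over lists, so that it can be evaluated. Testing the edges to cyclic
  successors reaches every edge, by symmetry, and every vertex.\<close>

definition bags_ok :: "nat \<Rightarrow> nat \<Rightarrow> nat list \<Rightarrow> (nat \<times> nat) list list \<Rightarrow> bool" where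
  "bags_ok m n ps bs \<longleftrightarrow> bs \<noteq> [] \<and>
     list_all (\<lambda>i. i = 0 \<or> ps ! i < i) [0..<length bs] \<and>
     list_all (\<lambda>i. list_all (\<lambda>j. list_all (\<lambda>v. v \<in> set (bs ! j) \<longrightarrow> v \<in> set (bs ! (ps ! i))) (bs ! i))
       [0..<i]) [0..<length bs] \<and>
     list_all (list_all (\<lambda>(i, j). i < m \<and> j < n)) bs \<and>
     list_all (\<lambda>i. list_all (\<lambda>j.
       list_ex (\<lambda>b. (i, j) \<in> set b \<and> (Suc i mod m, j) \<in> set b) bs \<and>
       list_ex (\<lambda>b. (i, j) \<in> set b \<and> (i, Suc j mod n) \<in> set b) bs) [0..<n]) [0..<m]"

lemma rooted_decomposition_bags:
  assumes "bags_ok m n ps bs"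
  shows "rooted_decomposition (toroidal_grid m n) (length bs) ((!) ps) (\<lambda>i. set (bs ! i))"
proof -
  let ?G = "toroidal_grid m n"
  have sub: "v \<in> pverts ?G" if "i < length bs" "v \<in> set (bs ! i)" for i v
  proof -
    have "list_all (list_all (\<lambda>(i, j). i < m \<and> j < n)) bs" using assms by (simp add: bags_ok_def)
    then have "list_all (\<lambda>(i, j). i < m \<and> j < n) (bs ! i)"
      using that(1) unfolding list_all_length[of _ bs] by blast
    then show ?thesis using that(2) by (auto simp: list_all_iff pverts_toroidal_grid)
  qed
  have h: "\<exists>k<length bs. (i, j) \<in> set (bs ! k) \<and> (Suc i mod m, j) \<in> set (bs ! k)"
    and v: "\<exists>k<length bs. (i, j) \<in> set (bs ! k) \<and> (i, Suc j mod n) \<in> set (bs ! k)"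
    if "i < m" "j < n" for i j
    using assms that by (auto simp: bags_ok_def list_all_iff list_ex_length)
  have "\<exists>k<length bs. u \<in> set (bs ! k) \<and> w \<in> set (bs ! k)" if "(u, w) \<in> parcs ?G" for u w
  proof -
    obtain a b c d where uw: "u = (a, b)" "w = (c, d)" by (cases u; cases w)
    then have "a < m \<and> b < n \<and> (w = (Suc a mod m, b) \<or> w = (a, Suc b mod n)) \<or>
        c < m \<and> d < n \<and> (u = (Suc c mod m, d) \<or> u = (c, Suc d mod n))"
      using that by (auto simp: parcs_toroidal_grid)
    then show ?thesis using h[of a b] v[of a b] h[of c d] v[of c d] uw by blast
  qed
  moreover have "(\<Union>i<length bs. set (bs ! i)) = pverts ?G"
    using sub h by (fastforce simp: pverts_toroidal_grid)
  moreover have "ps ! i < i" if "i < length bs" "0 < i" for i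
  proof -
    have "list_all (\<lambda>i. i = 0 \<or> ps ! i < i) [0..<length bs]" using assms by (simp add: bags_ok_def)
    then show ?thesis using that by (fastforce simp: list_all_length)
  qed
  moreover have "set (bs ! i) \<inter> set (bs ! j) \<subseteq> set (bs ! (ps ! i))" if "i < length bs" "j < i" for i j
  proof -
    have "list_all (\<lambda>i. list_all (\<lambda>j. list_all (\<lambda>v. v \<in> set (bs ! j) \<longrightarrow> v \<in> set (bs ! (ps ! i)))
        (bs ! i)) [0..<i]) [0..<length bs]" using assms by (simp add: bags_ok_def)
    then have "list_all (\<lambda>v. v \<in> set (bs ! j) \<longrightarrow> v \<in> set (bs ! (ps ! i))) (bs ! i)"
      using that by (simp add: list_all_iff)
    then show ?thesis by (auto simp: list_all_iff)
  qed
  moreover have "0 < length bs" using assms by (simp add: bags_ok_def)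
  ultimately show ?thesis unfolding rooted_decomposition_def by blast
qed

lemma treewidth_le_bags:
  assumes "3 \<le> m" "3 \<le> n" "bags_ok m n ps bs" "list_all (\<lambda>b. length b \<le> k + 1) bs"
  shows "treewidth (toroidal_grid m n) \<le> int k"
proof -
  interpret torus m n using assms by unfold_locales
  have "int (card (set (bs ! i))) \<le> int k + 1" if "i < length bs" for i
    using assms(4) card_length[of "bs ! i"] that by (fastforce simp: list_all_length)
  then show ?thesis by (rule treewidth_le[OF pair_graph_T rooted_decomposition_bags[OF assms(3)]])
qed

lemma treewidth_toroidal_grid_4_3_le: "treewidth (toroidal_grid 4 3) \<le> 5"
proof -
  \<comment> \<open>Bag \<open>i\<close> hangs below bag \<open>?ps ! i\<close>; the entry of the
    root is a filler. No bag exceeds six vertices.\<close>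
  let ?ps = "[0, 0, 1, 2, 1, 1, 5]"
  let ?bs = "[
    [(0, 2), (1, 1), (2, 2), (3, 0), (3, 1), (3, 2)],
    [(0, 2), (1, 0), (1, 1), (2, 2), (3, 0), (3, 1)],
    [(1, 0), (1, 1), (2, 1), (2, 2), (3, 0), (3, 1)],
    [(1, 0), (2, 0), (2, 1), (2, 2), (3, 0)],
    [(0, 2), (1, 0), (1, 1), (1, 2), (2, 2)],
    [(0, 1), (0, 2), (1, 0), (1, 1), (3, 0), (3, 1)],
    [(0, 0), (0, 1), (0, 2), (1, 0), (3, 0)]]"
  have "bags_ok 4 3 ?ps ?bs" by code_simp
  then have "treewidth (toroidal_grid 4 3) \<le> int 5" by (rule treewidth_le_bags[rotated 2]) simp_all
  then show ?thesis by simp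
qed

lemma treewidth_toroidal_grid_4_4_le: "treewidth (toroidal_grid 4 4) \<le> 6"
proof -
  \<comment> \<open>Six of the eight vertices with even coordinate sum occur only in a bag of five,
    their closed neighbourhood, which hangs below a bag containing the four neighbours.\<close>
  let ?ps = "[0, 0, 1, 2, 2, 4, 4, 4, 2, 4]"
  let ?bs = "[
    [(0, 3), (2, 1), (2, 3), (3, 0), (3, 1), (3, 2), (3, 3)],
    [(0, 1), (0, 3), (2, 1), (2, 3), (3, 0), (3, 1), (3, 2)],
    [(0, 1), (0, 3), (1, 2), (2, 1), (2, 3), (3, 0), (3, 2)],
    [(1, 2), (2, 1), (2, 2), (2, 3), (3, 2)],
    [(0, 1), (0, 3), (1, 0), (1, 2), (2, 1), (2, 3), (3, 0)],
    [(1, 0), (2, 0), (2, 1), (2, 3), (3, 0)],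
    [(0, 3), (1, 0), (1, 2), (1, 3), (2, 3)],
    [(0, 1), (1, 0), (1, 1), (1, 2), (2, 1)],
    [(0, 1), (0, 2), (0, 3), (1, 2), (3, 2)],
    [(0, 0), (0, 1), (0, 3), (1, 0), (3, 0)]]"
  have "bags_ok 4 4 ?ps ?bs" by code_simp
  then have "treewidth (toroidal_grid 4 4) \<le> int 6" by (rule treewidth_le_bags[rotated 2]) simp_all
  then show ?thesis by simp
qed

section \<open>Exchanging the two factors\<close>

lemma treewidth_toroidal_grid_swap_le:
  assumes "3 \<le> m" "3 \<le> n"
  shows "treewidth (toroidal_grid m n) \<le> treewidth (toroidal_grid n m)"
proof -
  interpret torus m n using assms by unfold_locales
  have "pair_graph (toroidal_grid n m)"
    using assms unfolding toroidal_grid_def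
    by (intro pair_graph_cartesian_product pair_graph_cycle_graph) auto
  then obtain U :: "nat pair_pre_digraph" and V
    where U: "tree_decomposition (toroidal_grid n m) U V"
      "decomposition_width U V = treewidth (toroidal_grid n m)"
    using treewidth_attained by metis
  define V' where "V' t = prod.swap ` V t" for t
  have mem: "(a, b) \<in> V' t \<longleftrightarrow> (b, a) \<in> V t" for a b t by (force simp: V'_def)
  note td = U(1)[unfolded tree_decomposition_def pverts_toroidal_grid]
  have cover: "(\<Union>t\<in>pverts U. V t) = {..<n} \<times> {..<m}" using td by (elim conjE)
  have edge: "\<exists>t\<in>pverts U. (a, b) \<in> V t \<and> (c, d) \<in> V t"
    if "((a, b), (c, d)) \<in> parcs (toroidal_grid n m)" for a b c d
  proof -
    have "\<forall>(u, v)\<in>parcs (toroidal_grid n m). \<exists>t\<in>pverts U. u \<in> V t \<and> v \<in> V t" using td by (elim conjE)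
    from bspec[OF this that] show ?thesis by simp
  qed
  have path: "(a, b) \<in> V t"
    if "t1 \<in> pverts U" "t2 \<in> pverts U" "(a, b) \<in> V t1" "(a, b) \<in> V t2" "vpath q U"
      "hd q = t1" "last q = t2" "t \<in> set q" for t1 t2 a b q t
  proof -
    have "\<forall>t1\<in>pverts U. \<forall>t2\<in>pverts U. \<forall>v\<in>V t1 \<inter> V t2. \<forall>p. vpath p U \<and> hd p = t1 \<and> last p = t2 \<longrightarrow>
        (\<forall>t'\<in>set p. v \<in> V t')"
      using td by (elim conjE)
    moreover have "(a, b) \<in> V t1 \<inter> V t2" using that by simp
    ultimately have "vpath q U \<and> hd q = t1 \<and> last q = t2 \<longrightarrow> (\<forall>t'\<in>set q. (a, b) \<in> V t')"
      using that(1,2) by blast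
    then show ?thesis using that by simp
  qed
  have "(\<Union>t\<in>pverts U. V' t) = prod.swap ` (\<Union>t\<in>pverts U. V t)"
    unfolding V'_def image_UN ..
  then have cover': "(\<Union>t\<in>pverts U. V' t) = pverts T"
    unfolding cover pverts_toroidal_grid by (simp add: product_swap)
  have "tree_decomposition T U V'"
    unfolding tree_decomposition_def
  proof (intro conjI cover' ballI allI impI)
    show "undirected_tree U" using td by (elim conjE)
    fix e assume "e \<in> parcs T"
    then obtain a b c d where e: "e = ((a, b), (c, d))" "((a, b), (c, d)) \<in> parcs T"
      by (metis surj_pair)
    then have "((b, a), (d, c)) \<in> parcs (toroidal_grid n m)" unfolding parcs_toroidal_grid by blast
    then show "case e of (u, v) \<Rightarrow> \<exists>t\<in>pverts U. u \<in> V' t \<and> v \<in> V' t"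
      using edge unfolding e(1) by (simp add: mem)
  next
    fix t1 t2 v q t
    assume t: "t1 \<in> pverts U" "t2 \<in> pverts U" "v \<in> V' t1 \<inter> V' t2"
      "vpath q U \<and> hd q = t1 \<and> last q = t2" "t \<in> set q"
    obtain a b where v: "v = (a, b)" by (cases v)
    have "(b, a) \<in> V t1" "(b, a) \<in> V t2" using t(3) unfolding v by (simp_all add: mem)
    then have "(b, a) \<in> V t" using path[OF t(1,2) _ _ _ _ _ t(5)] t(4) by blast
    then show "v \<in> V' t" unfolding v mem .
  qed
  moreover have "decomposition_width U V' = decomposition_width U V"
    unfolding decomposition_width_def V'_def by (simp add: card_image)
  ultimately show ?thesis using treewidth_attained[OF pair_graph_T] U(2) by metis
qed

lemma treewidth_toroidal_grid_commute:
  assumes "3 \<le> m" "3 \<le> n"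
  shows "treewidth (toroidal_grid m n) = treewidth (toroidal_grid n m)"
  using treewidth_toroidal_grid_swap_le assms by (simp add: order_antisym)

section \<open>The lower bound 8 for the \<open>5 \<times> 4\<close> torus\<close>

lemma cycle_4:
  assumes "p < 4"
  obtains p1 p2 p3 where "Suc p mod 4 = p1" "Suc p1 mod 4 = p2" "Suc p2 mod 4 = p3" "Suc p3 mod 4 = p"
    "distinct [p, p1, p2, p3]" "{..<4} = {p, p1, p2, p3}"
proof -
  have *: "{..<4::nat} = {0, 1, 2, 3}" by auto
  consider "p = 0" | "p = 1" | "p = 2" | "p = 3" using assms by linarith
  then show thesis
  proof cases
    case 1 then show ?thesis using * by (intro that[of 1 2 3]) auto
  next
    case 2 then show ?thesis using * by (intro that[of 2 3 0]) auto
  next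
    case 3 then show ?thesis using * by (intro that[of 3 0 1]) auto
  next
    case 4 then show ?thesis using * by (intro that[of 0 1 2]) auto
  qed
qed

lemma cycle_5:
  assumes "i < 5"
  obtains i1 i2 i3 i4 where "Suc i mod 5 = i1" "Suc i1 mod 5 = i2" "Suc i2 mod 5 = i3" "Suc i3 mod 5 = i4"
    "Suc i4 mod 5 = i" "distinct [i, i1, i2, i3, i4]" "{..<5} = {i, i1, i2, i3, i4}"
proof -
  have *: "{..<5::nat} = {0, 1, 2, 3, 4}" by auto
  consider "i = 0" | "i = 1" | "i = 2" | "i = 3" | "i = 4" using assms by linarith
  then show thesis
  proof cases
    case 1 then show ?thesis using * by (intro that[of 1 2 3 4]) auto
  next
    case 2 then show ?thesis using * by (intro that[of 2 3 4 0]) auto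
  next
    case 3 then show ?thesis using * by (intro that[of 3 4 0 1]) auto
  next
    case 4 then show ?thesis using * by (intro that[of 4 0 1 2]) auto
  next
    case 5 then show ?thesis using * by (intro that[of 0 1 2 3]) auto
  qed
qed

lemma linked_insert:
  assumes "symmetric (with_proj G)" "linked G A" "a \<in> A" "(a, b) \<in> parcs G"
  shows "linked G (insert b A)"
  using linked_Un[OF assms(1,2) linked_singleton[of G b] assms(3), of b] assms(4) by simp

lemma linked_pair:
  assumes "symmetric (with_proj G)" "(a, b) \<in> parcs G"
  shows "linked G {b, a}"
  using linked_insert[OF assms(1) linked_singleton[of G a], of a b] assms(2) by simp

context torus
begin

lemma neighbours:
  assumes "((a, b), w) \<in> parcs T" "a' < m" "b' < n" "Suc a' mod m = a" "Suc b' mod n = b"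
  shows "w \<in> {(Suc a mod m, b), (a', b), (a, Suc b mod n), (a, b')}"
proof -
  have inj: "x = y" if "x < N" "y < N" "Suc x mod N = Suc y mod N" for x y N :: nat
    using that by (auto simp: mod_Suc split: if_splits)
  obtain c d where w: "w = (c, d)" by (cases w)
  show ?thesis
    using assms(1) inj[of c m a'] inj[of d n b'] assms(2-) unfolding w parcs_toroidal_grid by auto
qed

text \<open>Unless a column is free, at least \<open>2 * m - card X\<close>, hence three, columns
  are met once, and only the columns \<open>q\<close> and \<open>q'\<close> can fail to touch the
  rows.\<close>

lemma column_touching_two_rows:
  assumes "n < m" and X: "X \<subseteq> pverts T" "card X < 2 * n" and j: "j < n" "j' < n"
  obtains i p where "i < m" "col i p \<inter> X = {}" "i \<noteq> q \<or> j \<noteq> p" "i \<noteq> q' \<or> j' \<noteq> p"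
proof (cases "\<exists>i<m. card {j. (i, j) \<in> X} = 0")
  case True
  then obtain i where "i < m" "card {j. (i, j) \<in> X} = 0" by (elim exE conjE)
  then show ?thesis using full_column_avoid[OF X(1), of i] that[of i n] j by simp
next
  case False
  let ?I = "{i. i < m \<and> card {j. (i, j) \<in> X} = 1}"
  have "2 * m \<le> card X + card ?I" by (rule column_ones[OF X(1)]) (use False in auto)
  then have "3 \<le> card ?I" using assms(1) X(2) by linarith
  moreover have "card {q, q'} \<le> 2" by (simp add: card_insert_if)
  ultimately have "\<not> ?I \<subseteq> {q, q'}" using card_mono[of "{q, q'}" ?I] by auto
  then obtain i where i: "i < m" "card {j. (i, j) \<in> X} = 1" "i \<noteq> q" "i \<noteq> q'" by blast
  obtain p where "col i p \<inter> X = {}" using column_avoid[OF X(1), of i] i(2) by (metis order_refl)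
  then show ?thesis using i that[of i p] by simp
qed

lemma rows_joined:
  assumes "n < m" and X: "X \<subseteq> pverts T" "card X < 2 * n" and j: "j < n" "j' < n"
    and q: "row j q \<inter> X = {}" "row j' q' \<inter> X = {}"
  shows "joined T X (row j q) (row j' q')"
proof -
  obtain i p where i: "i < m" "col i p \<inter> X = {}" "i \<noteq> q \<or> j \<noteq> p" "i \<noteq> q' \<or> j' \<noteq> p"
    using column_touching_two_rows[OF assms(1) X j] .
  have "joined T X (col i p) (row j q)" "joined T X (col i p) (row j' q')"
    using joined_row[OF linked_col[OF i(1)] i(2) order_refl q(1) i(1) j(1) i(3)]
      joined_row[OF linked_col[OF i(1)] i(2) order_refl q(2) i(1) j(2) i(4)] .
  then show ?thesis using joined_trans[OF sym_T] joined_sym col_nonempty by blast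
qed

end

locale torus_5_4 = torus 5 4
begin

text \<open>With these members in the family, a set that meets all members has at least two vertices
  in every row, so a set of eight has exactly two.\<close>

definition containing_row :: "(nat \<times> nat) set set" where
  "containing_row = {L. linked T L \<and> (\<exists>j<4. \<exists>q. row j q \<subseteq> L)}"

text \<open>
  The column \<open>i\<close> without \<open>(i, p)\<close> and two more vertices: seven vertices suffice to cut this set off,
  but not a larger one.
\<close>
definition small_piece :: "nat \<Rightarrow> nat \<Rightarrow> (nat \<times> nat) set" where
  "small_piece i p = col i p \<union>
     {(a, b). b = Suc (Suc p mod 4) mod 4 \<and> (a = Suc i mod 5 \<or> i = Suc a mod 5)}"

definition beyond_small_piece :: "(nat \<times> nat) set set" where
  "beyond_small_piece =
     {L. linked T L \<and> (\<exists>i<5. \<exists>p<4. col i p \<subseteq> L \<and> \<not> L \<subseteq> small_piece i p)}"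

text \<open>Otherwise the rows contain 1, 2, 2 and 2 vertices of \<open>X\<close>. These seven are
  then so constrained that the part they cut off around column \<open>i\<close> lies inside
  \<open>small_piece i p\<close>.\<close>

lemma beyond_small_piece_joined_row:
  assumes X: "X \<subseteq> pverts T" "card X < 8"
    and L: "L \<in> beyond_small_piece" "L \<subseteq> pverts T" "L \<inter> X = {}"
  shows "\<exists>j<4. \<exists>q. row j q \<inter> X = {} \<and> joined T X L (row j q)"
proof (rule ccontr)
  assume no: "\<not> ?thesis"
  obtain i p where ip: "i < 5" "p < 4" and link: "linked T L" and col: "col i p \<subseteq> L"
    and big: "\<not> L \<subseteq> small_piece i p"
    using L(1) by (auto simp: beyond_small_piece_def)
  obtain p1 p2 p3 where p: "Suc p mod 4 = p1" "Suc p1 mod 4 = p2" "Suc p2 mod 4 = p3" "Suc p3 mod 4 = p"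
    "distinct [p, p1, p2, p3]" "{..<4} = {p, p1, p2, p3}"
    using cycle_4[OF ip(2)] .
  obtain i1 i2 i3 i4 where i: "Suc i mod 5 = i1" "Suc i1 mod 5 = i2" "Suc i2 mod 5 = i3" "Suc i3 mod 5 = i4"
    "Suc i4 mod 5 = i" "distinct [i, i1, i2, i3, i4]" "{..<5} = {i, i1, i2, i3, i4}"
    using cycle_5[OF ip(1)] .
  have lt: "i1 < 5" "i2 < 5" "i3 < 5" "i4 < 5" "p1 < 4" "p2 < 4" "p3 < 4"
    using i(7) p(6) by blast+
  \<comment> \<open>A row free of \<open>X\<close> up to a vertex touches \<open>col i p\<close>
    unless both omit their crossing, so only row \<open>p\<close> without \<open>(i, p)\<close> is
    left.\<close>
  have only: "j = p \<and> q = i" if "j < 4" "row j q \<inter> X = {}" for j q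
    using joined_row[OF link L(3) col that(2) ip(1) that(1)] no that by blast
  have two: "2 \<le> card {a. (a, j) \<in> X}" if "j < 4" "j \<noteq> p" for j
  proof (rule ccontr)
    assume "\<not> ?thesis"
    then have "card {a. (a, j) \<in> X} \<le> 1" by simp
    from row_avoid[OF X(1) this] obtain q where "{a. (a, j) \<in> X} \<subseteq> {q}" "row j q \<inter> X = {}" .
    then show False using only[OF that(1)] that(2) by blast
  qed
  have sum: "card {a. (a, p) \<in> X} + card {a. (a, p1) \<in> X} + card {a. (a, p2) \<in> X} +
      card {a. (a, p3) \<in> X} < 8"
    using X(2) p(5) unfolding sum_rows[OF X(1), symmetric] p(6) by simp
  have rows: "2 \<le> card {a. (a, p1) \<in> X}" "2 \<le> card {a. (a, p2) \<in> X}" "2 \<le> card {a. (a, p3) \<in> X}"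
    using two lt p(5) by auto
  then have "card {a. (a, p) \<in> X} \<le> 1" using sum by linarith
  from row_avoid[OF X(1) this] obtain q where q: "{a. (a, p) \<in> X} \<subseteq> {q}" "row p q \<inter> X = {}" .
  then have "q = i" using only[OF ip(2)] by blast
  have "row p 5 \<inter> X \<noteq> {}" using only[OF ip(2), of 5] ip(1) by auto
  then have "card {a. (a, p) \<in> X} \<noteq> 0" using full_row_avoid[OF X(1)] by blast
  then have le2: "card {a. (a, p1) \<in> X} \<le> 2" "card {a. (a, p2) \<in> X} \<le> 2" "card {a. (a, p3) \<in> X} \<le> 2"
    using sum rows by linarith+
  have full: "a'' = a \<or> a'' = a'" if "card {a. (a, j) \<in> X} \<le> 2" "(a, j) \<in> X" "(a', j) \<in> X" "a \<noteq> a'" "(a'', j) \<in> X"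
    for a a' a'' j
  proof (rule ccontr)
    assume "\<not> ?thesis"
    then have "card {a, a', a''} = 3" using that(4) by auto
    moreover have "card {a, a', a''} \<le> card {a. (a, j) \<in> X}"
      using that by (intro card_mono finite_row_section[OF X(1)]) auto
    ultimately show False using that(1) by linarith
  qed
  \<comment> \<open>The vertices reachable from \<open>L\<close> off \<open>X\<close>. Row
    \<open>p\<close> outside column \<open>i\<close> is free of \<open>X\<close> but not in
    \<open>C\<close>, as reaching it would join \<open>L\<close> to that row.\<close>
  define C where "C = {v. joined T X L {v}}"
  have LC: "v \<in> C" if "v \<in> L" for v
    using that link L(3) unfolding C_def joined_def by blast
  have step: "w \<in> C" if vC: "v \<in> C" and "(v, w) \<in> parcs T \<or> (w, v) \<in> parcs T" and "w \<notin> X" for v w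
  proof -
    obtain D where D: "linked T D" "L \<union> {v} \<subseteq> D" "D \<inter> X = {}"
      using vC unfolding C_def joined_def by blast
    have "(v, w) \<in> parcs T" using that(2) T.arcs_symmetric by blast
    then have "linked T (insert w D)" using D linked_insert[OF sym_T D(1)] by blast
    then show ?thesis using D that(3) unfolding C_def joined_def by blast
  qed
  have notC: "(a, p) \<notin> C" if "a < 5" "a \<noteq> i" for a
  proof
    assume "(a, p) \<in> C"
    then have "joined T X L {(a, p)}" by (simp add: C_def)
    moreover have "joined T X {(a, p)} (row p q)"
    proof -
      have "(a, p) \<in> row p q" using that \<open>q = i\<close> by (simp add: row_without_def)
      then show ?thesis using linked_row[OF ip(2), of q] q(2) unfolding joined_def by blast
    qed
    ultimately have "joined T X L (row p q)" using joined_trans[OF sym_T] by blast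
    then show False using no q(2) ip(2) by blast
  qed
  have freeX: "(a, p) \<notin> X" if "a \<noteq> i" for a using q(1) \<open>q = i\<close> that by blast
  have colC: "(i, p1) \<in> C" "(i, p2) \<in> C" "(i, p3) \<in> C"
    using LC col lt p(5) by (auto simp: column_without_def)
  note h = adj_horizontal[of i] adj_horizontal[of i1] adj_horizontal[of i2] adj_horizontal[of i3]
    adj_horizontal[of i4]
  note v = adj_vertical[of _ p] adj_vertical[of _ p1] adj_vertical[of _ p2] adj_vertical[of _ p3]
  have hadj: "((i, j), (i1, j)) \<in> parcs T" "((i1, j), (i2, j)) \<in> parcs T" "((i2, j), (i3, j)) \<in> parcs T"
    "((i3, j), (i4, j)) \<in> parcs T" "((i4, j), (i, j)) \<in> parcs T" if "j < 4" for j
    using h that lt ip i by simp_all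
  have vadj: "((a, p), (a, p1)) \<in> parcs T" "((a, p1), (a, p2)) \<in> parcs T" "((a, p2), (a, p3)) \<in> parcs T"
    "((a, p3), (a, p)) \<in> parcs T" if "a < 5" for a
    using v that lt ip p by simp_all
  have neq: "i1 \<noteq> i" "i2 \<noteq> i" "i3 \<noteq> i" "i4 \<noteq> i" "i1 \<noteq> i4" "i2 \<noteq> i1" "i2 \<noteq> i4" "i3 \<noteq> i1" "i3 \<noteq> i4"
    using i(6) by auto
  \<comment> \<open>From \<open>(i, p1)\<close> one could pass through \<open>(i1, p1)\<close> to
    the free vertex \<open>(i1, p)\<close>, so \<open>X\<close> must block here. The other three
    corners are alike.\<close>
  have x11: "(i1, p1) \<in> X"
    using step[OF colC(1), of "(i1, p1)"] step[of "(i1, p1)" "(i1, p)"] hadj(1) vadj(1) lt notC freeX neq by blast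
  have x41: "(i4, p1) \<in> X"
    using step[OF colC(1), of "(i4, p1)"] step[of "(i4, p1)" "(i4, p)"] hadj(5) vadj(1) lt notC freeX neq by blast
  have x13: "(i1, p3) \<in> X"
    using step[OF colC(3), of "(i1, p3)"] step[of "(i1, p3)" "(i1, p)"] hadj(1) vadj(4) lt notC freeX neq by blast
  have x43: "(i4, p3) \<in> X"
    using step[OF colC(3), of "(i4, p3)"] step[of "(i4, p3)" "(i4, p)"] hadj(5) vadj(4) lt notC freeX neq by blast
  have n21: "(i2, p1) \<notin> X" "(i3, p1) \<notin> X"
    using full[OF le2(1) x11 x41] neq by auto
  \<comment> \<open>Row \<open>p1\<close> has used up its two hits, so \<open>(i2, p1)\<close> is
    free, and the way \<open>(i1, p2)\<close>, \<open>(i2, p2)\<close>, \<open>(i2, p1)\<close>,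
    \<open>(i2, p)\<close> must be blocked at one of the first two.\<close>
  have x2: "(i1, p2) \<in> X \<or> (i2, p2) \<in> X"
    using step[OF colC(2), of "(i1, p2)"] step[of "(i1, p2)" "(i2, p2)"] step[of "(i2, p2)" "(i2, p1)"]
      step[of "(i2, p1)" "(i2, p)"] hadj(1,2)[OF lt(6)] vadj(1,2)[OF lt(2)] notC[OF lt(2)] freeX neq n21 by blast
  have x3: "(i4, p2) \<in> X \<or> (i3, p2) \<in> X"
    using step[OF colC(2), of "(i4, p2)"] step[of "(i4, p2)" "(i3, p2)"] step[of "(i3, p2)" "(i3, p1)"]
      step[of "(i3, p1)" "(i3, p)"] hadj(4,5)[OF lt(6)] vadj(1,2)[OF lt(3)] notC[OF lt(3)] freeX neq n21 by blast
  \<comment> \<open>The vertices of \<open>small_piece i p\<close> on the torus. No step off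
    \<open>X\<close> leaves this set, since the vertices of \<open>X\<close> found so far surround
    it.\<close>
  define P where "P = {(i, p1), (i, p2), (i, p3), (i1, p2), (i4, p2)}"
  have Psub: "P \<subseteq> small_piece i p"
    using p(1-5) i(1,5) lt by (auto simp: P_def small_piece_def column_without_def)
  have xip: "(i, p) \<in> X"
  proof -
    have "{a. (a, p) \<in> X} \<noteq> {}" using \<open>card {a. (a, p) \<in> X} \<noteq> 0\<close> by (metis card.empty)
    then show ?thesis using q(1) \<open>q = i\<close> by blast
  qed
  have closed: "w \<in> P" if u: "u \<in> P" "(u, w) \<in> parcs T" "u \<notin> X" "w \<notin> X" for u w
  proof -
    have w1: "w \<in> {(i1, p1), (i4, p1), (i, p2), (i, p)}" if "u = (i, p1)"
      using neighbours[OF u(2)[unfolded that] lt(4) ip(2) i(5) p(1)] unfolding i(1) p(2) .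
    have w2: "w \<in> {(i1, p2), (i4, p2), (i, p3), (i, p1)}" if "u = (i, p2)"
      using neighbours[OF u(2)[unfolded that] lt(4) lt(5) i(5) p(2)] unfolding i(1) p(3) .
    have w3: "w \<in> {(i1, p3), (i4, p3), (i, p), (i, p2)}" if "u = (i, p3)"
      using neighbours[OF u(2)[unfolded that] lt(4) lt(6) i(5) p(3)] unfolding i(1) p(4) .
    have w4: "w \<in> {(i2, p2), (i, p2), (i1, p3), (i1, p1)}" if "u = (i1, p2)"
      using neighbours[OF u(2)[unfolded that] ip(1) lt(5) i(1) p(2)] unfolding i(2) p(3) .
    have w5: "w \<in> {(i, p2), (i3, p2), (i4, p3), (i4, p1)}" if "u = (i4, p2)"
      using neighbours[OF u(2)[unfolded that] lt(3) lt(5) i(4) p(2)] unfolding i(5) p(3) .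
    have "w \<noteq> (i, p)" "w \<noteq> (i1, p1)" "w \<noteq> (i4, p1)" "w \<noteq> (i1, p3)" "w \<noteq> (i4, p3)"
      "u = (i1, p2) \<Longrightarrow> w \<noteq> (i2, p2)" "u = (i4, p2) \<Longrightarrow> w \<noteq> (i3, p2)"
      using u(3,4) xip x11 x41 x13 x43 x2 x3 by blast+
    then show ?thesis using u(1) w1 w2 w3 w4 w5 unfolding P_def by blast
  qed
  have "(i, p1) \<in> L" using col lt p(5) by (auto simp: column_without_def)
  have "L \<subseteq> P"
  proof
    fix u assume "u \<in> L"
    then have "((i, p1), u) \<in> (parcs T \<inter> L \<times> L)\<^sup>*"
      using link \<open>(i, p1) \<in> L\<close> unfolding linked_def by blast
    then show "u \<in> P"
    proof (induction rule: rtrancl_induct)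
      case base
      show ?case by (simp add: P_def)
    next
      case (step y z)
      then show ?case using closed L(3) by blast
    qed
  qed
  then show False using Psub big by blast
qed

text \<open>Let the columns \<open>i\<close> and \<open>i2\<close> be met at heights
  \<open>p\<close> and \<open>h\<close>. At any other height the middle column must be met, or the
  row would link them. Having at most two hits there excludes \<open>h = p\<close>; for adjacent
  heights a path through the middle column links them; for opposite heights one of them extends
  beyond its small piece.\<close>

lemma two_columns_apart:
  assumes S: "S \<subseteq> pverts T" and rows: "\<And>j. j < 4 \<Longrightarrow> card {a. (a, j) \<in> S} = 2"
    and i: "i < 5" "Suc i mod 5 = i1" "Suc i1 mod 5 = i2"
    and col: "card {j. (i, j) \<in> S} = 1" "card {j. (i2, j) \<in> S} = 1" "card {j. (i1, j) \<in> S} \<le> 2"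
  shows "\<exists>L\<in>containing_two_columns \<union> beyond_small_piece. L \<noteq> {} \<and> L \<subseteq> pverts T \<and> L \<inter> S = {}"
proof (rule ccontr)
  assume no: "\<not> ?thesis"
  obtain i3 i4 where i': "Suc i2 mod 5 = i3" "Suc i3 mod 5 = i4" "Suc i4 mod 5 = i"
    "distinct [i, i1, i2, i3, i4]" "{..<5} = {i, i1, i2, i3, i4}"
    using cycle_5[OF i(1)] i(2,3) by metis
  have ilt: "i1 < 5" "i2 < 5" "i3 < 5" "i4 < 5" using i'(5) by blast+
  obtain p where p0: "{j. (i, j) \<in> S} = {p}" using col(1) by (rule card_1_singletonE)
  obtain h where h0: "{j. (i2, j) \<in> S} = {h}" using col(2) by (rule card_1_singletonE)
  have "p < 4" "h < 4" using p0 h0 S by (auto simp: pverts_toroidal_grid set_eq_iff)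
  obtain p1 p2 p3 where p: "Suc p mod 4 = p1" "Suc p1 mod 4 = p2" "Suc p2 mod 4 = p3" "Suc p3 mod 4 = p"
    "distinct [p, p1, p2, p3]" "{..<4} = {p, p1, p2, p3}"
    using cycle_4[OF \<open>p < 4\<close>] .
  have plt: "p1 < 4" "p2 < 4" "p3 < 4" using p(6) by blast+
  have c1: "(i, j) \<in> S \<longleftrightarrow> j = p" for j using p0 by blast
  have c2: "(i2, j) \<in> S \<longleftrightarrow> j = h" for j using h0 by blast
  have two: False if A: "linked T A" "A \<subseteq> pverts T" "A \<inter> S = {}" "(i, j) \<in> A" "(i2, j') \<in> A" for A j j'
  proof -
    have "i \<noteq> i2" using i'(4) by auto
    then show False
      using containing_two_columnsI[OF S A(1-3) i(1) ilt(2) _ _ _ A(4,5)] col no by auto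
  qed
  have hadj: "((i, j), (i1, j)) \<in> parcs T" "((i1, j), (i2, j)) \<in> parcs T" "((i4, j), (i, j)) \<in> parcs T"
    "((i2, j), (i3, j)) \<in> parcs T" if "j < 4" for j
    using adj_horizontal[of i j] adj_horizontal[of i1 j] adj_horizontal[of i4 j] adj_horizontal[of i2 j] that ilt i i'
    by simp_all
  have V: "(a, b) \<in> pverts T \<longleftrightarrow> a < 5 \<and> b < 4" for a b by (simp add: pverts_toroidal_grid)
  have unhit: "(i1, j) \<in> S" if "j < 4" "j \<noteq> p" "j \<noteq> h" for j
  proof (rule ccontr)
    assume "(i1, j) \<notin> S"
    have "linked T {(i2, j), (i1, j), (i, j)}"
      using linked_insert[OF sym_T linked_pair[OF sym_T hadj(1)[OF that(1)]], of "(i1, j)"] hadj(2)[OF that(1)] by simp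
    then show False
      using two[of "{(i2, j), (i1, j), (i, j)}" j j] \<open>(i1, j) \<notin> S\<close> c1 c2 that V i(1) ilt by simp
  qed
  have colS: "b'' = b \<or> b'' = b'" if "(i1, b) \<in> S" "(i1, b') \<in> S" "(i1, b'') \<in> S" "b \<noteq> b'" for b b' b''
  proof (rule ccontr)
    assume "\<not> ?thesis"
    then have "card {b, b', b''} = 3" using that(4) by auto
    moreover have "card {b, b', b''} \<le> card {j. (i1, j) \<in> S}"
      using that by (intro card_mono finite_column_section[OF S]) auto
    ultimately show False using col(3) by linarith
  qed
  \<comment> \<open>The path \<open>(i, g)\<close>, \<open>(i1, g)\<close>, \<open>(i1, p)\<close>,
    \<open>(i2, p)\<close> changes rows in the middle column and so avoids the hits at
    \<open>(i, p)\<close> and \<open>(i2, g)\<close>.\<close>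
  have near: False if g: "((i1, g), (i1, p)) \<in> parcs T \<or> ((i1, p), (i1, g)) \<in> parcs T" "h = g" "g < 4" "g \<noteq> p"
    "(i1, g) \<notin> S" "(i1, p) \<notin> S" for g
  proof -
    have e: "((i1, g), (i1, p)) \<in> parcs T" using g(1) T.arcs_symmetric by blast
    have "linked T {(i1, g), (i, g)}" using linked_pair[OF sym_T hadj(1)[OF g(3)]] .
    then have "linked T {(i1, p), (i1, g), (i, g)}" using linked_insert[OF sym_T _ _ e] by simp
    then have "linked T {(i2, p), (i1, p), (i1, g), (i, g)}"
      using linked_insert[OF sym_T _ _ hadj(2)[OF \<open>p < 4\<close>]] by simp
    then show False
      using two[of "{(i2, p), (i1, p), (i1, g), (i, g)}" g p] g c1 c2 V i(1) ilt \<open>p < 4\<close> by simp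
  qed
  have "h \<in> {p, p1, p2, p3}" using \<open>h < 4\<close> unfolding p(6)[symmetric] by simp
  then consider "h = p" | "h = p1" | "h = p2" | "h = p3" by blast
  then show False
  proof cases
    case 1
    then have "(i1, p1) \<in> S" "(i1, p2) \<in> S" "(i1, p3) \<in> S" using unhit plt p(5) by auto
    then show False using colS[of p1 p2 p3] p(5) by auto
  next
    case 2
    then have "(i1, p2) \<in> S" "(i1, p3) \<in> S" using unhit plt p(5) by auto
    then have "(i1, p) \<notin> S" "(i1, p1) \<notin> S" using colS[of p2 p3] p(5) by auto
    then show False
      using near[of p1] adj_vertical[of i1 p] p(1,5) ilt plt 2 \<open>p < 4\<close> by auto
  next
    case 4
    then have "(i1, p1) \<in> S" "(i1, p2) \<in> S" using unhit plt p(5) by auto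
    then have "(i1, p) \<notin> S" "(i1, p3) \<notin> S" using colS[of p1 p2] p(5) by auto
    then show False
      using near[of p3] adj_vertical[of i1 p3] p(4,5) ilt plt 4 \<open>p < 4\<close> by auto
  next
    case 3
    have x1: "(i1, p1) \<in> S" using unhit[of p1] 3 plt p(5) by auto
    have big: False if "linked T L" "a < 5" "b < 4" "L = insert w (col a b)" "w \<notin> small_piece a b"
      "w \<notin> S" "w \<in> pverts T" "col a b \<inter> S = {}" for L a b w
    proof -
      have "L \<in> beyond_small_piece" unfolding beyond_small_piece_def using that by blast
      moreover have "L \<subseteq> pverts T" "L \<inter> S = {}" "L \<noteq> {}" using that col_subset[of a b] by auto
      ultimately show False using no by blast
    qed
    \<comment> \<open>An extension of column \<open>i\<close> in row \<open>p1\<close> leaves its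
      small piece, whose extra vertices lie in row \<open>p2\<close>. If \<open>S\<close> prevents
      it, row \<open>p1\<close> has its two hits and column \<open>i2\<close> extends to
      \<open>(i3, p1)\<close>.\<close>
    have x4: "(i4, p1) \<in> S"
    proof (rule ccontr)
      assume neg: "(i4, p1) \<notin> S"
      have "(i, p1) \<in> col i p" using plt p(5) by (auto simp: column_without_def)
      then have "linked T (insert (i4, p1) (col i p))"
        using linked_insert[OF sym_T linked_col[OF i(1), of p] _ T.arcs_symmetric[OF hadj(3)[OF plt(1)]]] by blast
      moreover have "(i4, p1) \<notin> small_piece i p"
        using p(1,2,5) i'(4) by (auto simp: small_piece_def column_without_def)
      moreover have "col i p \<inter> S = {}" using c1 by (auto simp: column_without_def)
      ultimately show False using big[of _ i p "(i4, p1)"] neg i(1) \<open>p < 4\<close> V ilt plt by blast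
    qed
    have n3: "(i3, p1) \<notin> S"
    proof
      assume "(i3, p1) \<in> S"
      then have "card {i1, i3, i4} \<le> card {a. (a, p1) \<in> S}"
        using x1 x4 by (intro card_mono finite_row_section[OF S]) auto
      then show False using rows[OF plt(1)] i'(4) by auto
    qed
    have "(i2, p1) \<in> col i2 p2" using plt p(5) by (auto simp: column_without_def)
    then have "linked T (insert (i3, p1) (col i2 p2))"
      using linked_insert[OF sym_T linked_col[OF ilt(2), of p2] _ hadj(4)[OF plt(1)]] by blast
    moreover have "(i3, p1) \<notin> small_piece i2 p2"
      using p(2-5) i'(4) by (auto simp: small_piece_def column_without_def)
    moreover have "col i2 p2 \<inter> S = {}" using c2 3 by (auto simp: column_without_def)
    ultimately show False using big[of _ i2 p2 "(i3, p1)"] n3 V ilt plt by blast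
  qed
qed

text \<open>Eight vertices meeting all members would put two into each row and 1, 1, 2, 2, 2 into
  the columns. The two columns met once are adjacent or two apart on the cycle of length five, and
  either way some member is missed.\<close>

lemma treewidth_ge_8: "8 \<le> treewidth T"
proof -
  let ?F = "containing_two_columns \<union> containing_row \<union> beyond_small_piece"
  have "int 8 \<le> treewidth T"
  proof (rule treewidth_ge[OF pair_graph_T, of _ ?F])
    fix X L L' assume X: "X \<subseteq> pverts T" "card X < 8" and L: "L \<in> ?F" "L' \<in> ?F"
      "L \<subseteq> pverts T" "L' \<subseteq> pverts T" "L \<inter> X = {}" "L' \<inter> X = {}"
    have X': "card X < 2 * 4" using X(2) by simp
    have to_row: "\<exists>j<4. \<exists>q. row j q \<inter> X = {} \<and> joined T X L (row j q)"
      if L: "L \<in> ?F" "L \<subseteq> pverts T" "L \<inter> X = {}" for L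
    proof -
      consider "L \<in> containing_two_columns" | "L \<in> containing_row" | "L \<in> beyond_small_piece"
        using L(1) by blast
      then show ?thesis
      proof cases
        case 1
        obtain j where j: "j < 4" "card {i. (i, j) \<in> X} \<le> 1" using near_free_row[OF X(1) X'] by blast
        obtain q where q: "{i. (i, j) \<in> X} \<subseteq> {q}" "row j q \<inter> X = {}" using row_avoid[OF X(1) j(2)] .
        show ?thesis using containing_two_columns_joined_row[OF 1 L(3) q(2) j(1)] q(2) j(1) by blast
      next
        case 2
        then obtain j q where j: "linked T L" "j < 4" "row j q \<subseteq> L"
          unfolding containing_row_def by blast
        then have "joined T X L (row j q)" using L(3) unfolding joined_def by blast
        moreover have "row j q \<inter> X = {}" using j(3) L(3) by blast
        ultimately show ?thesis using j(2) by blast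
      next
        case 3
        show ?thesis by (rule beyond_small_piece_joined_row[OF X 3 L(2,3)])
      qed
    qed
    obtain j q where 1: "j < 4" "row j q \<inter> X = {}" "joined T X L (row j q)"
      using to_row[OF L(1,3,5)] by blast
    obtain j' q' where 2: "j' < 4" "row j' q' \<inter> X = {}" "joined T X L' (row j' q')"
      using to_row[OF L(2,4,6)] by blast
    have "joined T X (row j q) (row j' q')" by (rule rows_joined[OF _ X(1) X' 1(1) 2(1) 1(2) 2(2)]) simp
    then have "joined T X L L'"
      using joined_trans[OF sym_T joined_trans[OF sym_T 1(3)] joined_sym[OF 2(3)]] row_nonempty by blast
    then show "\<exists>C. linked T C \<and> L \<union> L' \<subseteq> C \<and> C \<inter> X = {}" unfolding joined_def .
  next
    fix S assume S: "S \<subseteq> pverts T" "card S \<le> 8"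
    show "\<exists>L\<in>?F. L \<noteq> {} \<and> L \<subseteq> pverts T \<and> L \<inter> S = {}"
    proof (rule ccontr)
      assume no: "\<not> ?thesis"
      have free: "card {j. (i, j) \<in> S} \<noteq> 0" if "i < 5" for i
        using containing_two_columns_full[OF S(1) that] no by blast
      have row2: "2 \<le> card {i. (i, j) \<in> S}" if "j < 4" for j
      proof (rule ccontr)
        assume "\<not> ?thesis"
        then have "card {i. (i, j) \<in> S} \<le> 1" by simp
        from row_avoid[OF S(1) this] obtain q where q: "{i. (i, j) \<in> S} \<subseteq> {q}" "row j q \<inter> S = {}" .
        have "row j q \<subseteq> pverts T" using that by (auto simp: row_without_def pverts_toroidal_grid)
        moreover have "row j q \<in> containing_row"
          using linked_row[OF that, of q] that unfolding containing_row_def by blast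
        ultimately show False using no q(2) row_nonempty[of j q] by blast
      qed
      have sum: "(\<Sum>j<4. card {i. (i, j) \<in> S}) = card S" by (rule sum_rows[OF S(1)])
      have rows: "card {i. (i, j) \<in> S} = 2" if "j < 4" for j
      proof (rule ccontr)
        assume "card {i. (i, j) \<in> S} \<noteq> 2"
        then have "2 < card {i. (i, j) \<in> S}" using row2[OF that] by simp
        then have "(\<Sum>j<(4::nat). 2) < (\<Sum>j<4. card {i. (i, j) \<in> S})"
          using row2 that by (intro sum_strict_mono_ex1) auto
        then show False using S(2) sum by simp
      qed
      then have card_S: "card S = 8" using sum by simp
      let ?K = "{i. i < 5 \<and> card {j. (i, j) \<in> S} = 1}"
      have "2 * 5 \<le> card S + card ?K" by (rule column_ones[OF S(1)]) (use free in auto)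
      then have K2: "2 \<le> card ?K" using card_S by linarith
      \<comment> \<open>Three columns met once have three hits, so one of the four rows contains
        none of these, and one of its two arcs meets two of the columns.\<close>
      have "\<not> 3 \<le> card ?K"
      proof
        assume "3 \<le> card ?K"
        then obtain K where K: "K \<subseteq> ?K" "card K = 3" "finite K" by (rule obtain_subset_with_card_n)
        have "card K < 1 * 4" using K(2) by simp
        then obtain j where j: "j < 4" "card {i \<in> K. (i, j) \<in> S} < 1"
          using row_few_hits[OF S(1) K(3)] K(1) by blast
        obtain a b where "{i. (i, j) \<in> S} = {a, b}" "a \<noteq> b"
          using rows[OF j(1)] unfolding card_2_iff by blast
        then have ab: "{i. (i, j) \<in> S} = {min a b, max a b}" "min a b \<le> max a b"
          by (auto simp: min_def max_def)
        have "max a b \<in> {i. (i, j) \<in> S}" unfolding ab(1) by simp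
        then have "max a b < 5" using S(1) by (auto simp: pverts_toroidal_grid)
        have "{i \<in> K. (i, j) \<in> S} = {}" using j(2) K(3) by simp
        then have "K - {min a b, max a b} = K" using ab(1) by blast
        then have "3 \<le> card (K - {min a b, max a b})" using K(2) by simp
        moreover have "K \<subseteq> {i. i < 5 \<and> card {j. (i, j) \<in> S} \<le> 1}" using K(1) by auto
        moreover have "{i. (i, j) \<in> S} \<subseteq> {min a b, max a b}" using ab(1) by simp
        ultimately show False
          using containing_two_columns_avoid[OF S(1) j(1) _ ab(2) \<open>max a b < 5\<close>] no by blast
      qed
      then have "card ?K = 2" using K2 by linarith
      then obtain c c' where c: "?K = {c, c'}" "c \<noteq> c'" unfolding card_2_iff by blast
      have "c \<in> ?K" "c' \<in> ?K" unfolding c(1) by simp_all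
      then have cc: "c < 5" "c' < 5" "card {j. (c, j) \<in> S} = 1" "card {j. (c', j) \<in> S} = 1" by simp_all
      have other: "2 \<le> card {j. (i, j) \<in> S}" if "i < 5" "i \<noteq> c" "i \<noteq> c'" for i
      proof -
        have "i \<notin> ?K" unfolding c(1) using that by simp
        then have "card {j. (i, j) \<in> S} \<noteq> 1" using that(1) by blast
        then show ?thesis using free[OF that(1)] by linarith
      qed
      have two: "card {j. (i, j) \<in> S} \<le> 2" if "i < 5" for i
      proof (rule ccontr)
        assume gt: "\<not> ?thesis"
        \<comment> \<open>These are lower bounds for the numbers of hits in the columns; they
          already sum to 8, so no column can exceed its bound.\<close>
        let ?w = "\<lambda>i. if i = c \<or> i = c' then 1 else 2 :: nat"
        have "i \<noteq> c" "i \<noteq> c'" using gt cc by auto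
        have "sum ?w {..<5} < (\<Sum>i<5. card {j. (i, j) \<in> S})"
          using other cc gt that \<open>i \<noteq> c\<close> \<open>i \<noteq> c'\<close> by (intro sum_strict_mono_ex1) force+
        moreover have "sum ?w {..<5} = 8"
        proof -
          have "sum ?w {..<5} = sum ?w {c, c'} + sum ?w ({..<5} - {c, c'})"
            using cc by (subst sum.subset_diff[of "{c, c'}"]) auto
          also have "sum ?w ({..<5} - {c, c'}) = 2 * card ({..<5} - {c, c'})" by simp
          also have "card ({..<5::nat} - {c, c'}) = 3" using cc c(2) by (subst card_Diff_subset) auto
          finally show ?thesis using c(2) by simp
        qed
        ultimately show False using sum_columns[OF S(1)] card_S by simp
      qed
      \<comment> \<open>The two hits spoil at most two of the four rows, so some edge between the
        columns is free.\<close>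
      have adjacent: False if a: "a < 5" "b < 5" "Suc a mod 5 = b" "a \<noteq> b"
        and one: "card {j. (a, j) \<in> S} = 1" "card {j. (b, j) \<in> S} = 1" for a b
      proof -
        obtain x where x: "{j. (a, j) \<in> S} = {x}" using one(1) by (rule card_1_singletonE)
        obtain y where y: "{j. (b, j) \<in> S} = {y}" using one(2) by (rule card_1_singletonE)
        have "\<not> {..<4} \<subseteq> {x, y}"
        proof
          assume "{..<4::nat} \<subseteq> {x, y}"
          then have "card {..<4::nat} \<le> card {x, y}" by (intro card_mono) auto
          then show False by (auto simp: card_insert_if split: if_splits)
        qed
        then obtain j where j: "j < 4" "j \<noteq> x" "j \<noteq> y" by blast
        then have "(a, j) \<notin> S" "(b, j) \<notin> S" using x y by blast+
        moreover have "((a, j), (b, j)) \<in> parcs T" using adj_horizontal[OF a(1) j(1)] a(3) by simp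
        then have "linked T {(b, j), (a, j)}" by (rule linked_pair[OF sym_T])
        moreover have "{(b, j), (a, j)} \<subseteq> pverts T" using a j by (simp add: pverts_toroidal_grid)
        ultimately show False
          using containing_two_columnsI[OF S(1) _ _ _ a(1,2,4), of "{(b, j), (a, j)}" j j] one no by auto
      qed
      obtain i1 i2 i3 i4 where i: "Suc c mod 5 = i1" "Suc i1 mod 5 = i2" "Suc i2 mod 5 = i3"
        "Suc i3 mod 5 = i4" "Suc i4 mod 5 = c" "distinct [c, i1, i2, i3, i4]" "{..<5} = {c, i1, i2, i3, i4}"
        using cycle_5[OF cc(1)] .
      have lt: "i1 < 5" "i4 < 5" using i(7) by blast+
      have "c' \<in> {c, i1, i2, i3, i4}" using cc(2) unfolding i(7)[symmetric] by simp
      then consider "c' = i1" | "c' = i2" | "c' = i3" | "c' = i4" using c(2) by blast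
      then show False
      proof cases
        case 1
        then show ?thesis using adjacent[OF cc(1,2) _ c(2) cc(3,4)] i(1) by simp
      next
        case 2
        then show ?thesis
          using two_columns_apart[OF S(1) rows cc(1) i(1,2) cc(3) _ two[OF lt(1)]] cc(4) no by blast
      next
        case 3
        have "Suc c' mod 5 = i4" using i(4) 3 by simp
        then show ?thesis
          using two_columns_apart[OF S(1) rows cc(2) _ i(5) cc(4) cc(3) two[OF lt(2)]] no by blast
      next
        case 4
        then show ?thesis using adjacent[OF cc(2,1) _ _ cc(4,3)] i(5) c(2) by simp
      qed
    qed
  qed
  then show ?thesis by simp
qed

end

lemma treewidth_toroidal_grid_5_4_ge: "8 \<le> treewidth (toroidal_grid 5 4)"
proof -
  interpret torus_5_4 by unfold_locales auto
  show ?thesis by (rule treewidth_ge_8)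
qed

section \<open>Collecting the bounds and the witnesses\<close>

lemma treewidth_toroidal_grid_bounds:
  assumes "3 \<le> n" "n \<le> m"
  shows "treewidth (toroidal_grid m n) \<le> 2 * int n" "2 * int n - 2 \<le> treewidth (toroidal_grid m n)"
    "n < m \<Longrightarrow> 2 * int n - 1 \<le> treewidth (toroidal_grid m n)"
    "n + 2 \<le> m \<Longrightarrow> 2 * int n \<le> treewidth (toroidal_grid m n)"
proof -
  interpret torus m n using assms by unfold_locales auto
  show "treewidth T \<le> 2 * int n" by (rule treewidth_le_2n)
  show "2 * int n - 2 \<le> treewidth T" by (rule treewidth_ge_2n_minus_2[OF assms(2)])
  show "n < m \<Longrightarrow> 2 * int n - 1 \<le> treewidth T" by (rule treewidth_ge_2n_minus_1)
  show "n + 2 \<le> m \<Longrightarrow> 2 * int n \<le> treewidth T" by (rule treewidth_ge_2n)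
qed

theorem theorem1p2:
  shows
    "(\<forall>m n :: nat. m \<ge> 3 \<and> n \<ge> 3 \<longrightarrow>
        (\<bar>int m - int n\<bar> \<ge> 2 \<longrightarrow>
           treewidth (toroidal_grid m n) = 2 * int (min m n)) \<and>
        (\<bar>int m - int n\<bar> = 1 \<longrightarrow>
           treewidth (toroidal_grid m n) = 2 * int (min m n) - 1 \<or>
           treewidth (toroidal_grid m n) = 2 * int (min m n)) \<and>
        (m = n \<longrightarrow>
           treewidth (toroidal_grid m n) = 2 * int n - 2 \<or>
           treewidth (toroidal_grid m n) = 2 * int n - 1)) \<and>
     (\<exists>m n :: nat. m \<ge> 3 \<and> n \<ge> 3 \<and> \<bar>int m - int n\<bar> = 1 \<and>
        treewidth (toroidal_grid m n) = 2 * int (min m n) - 1) \<and>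
     (\<exists>m n :: nat. m \<ge> 3 \<and> n \<ge> 3 \<and> \<bar>int m - int n\<bar> = 1 \<and>
        treewidth (toroidal_grid m n) = 2 * int (min m n)) \<and>
     (\<exists>n :: nat. n \<ge> 3 \<and> treewidth (toroidal_grid n n) = 2 * int n - 2) \<and>
     (\<exists>n :: nat. n \<ge> 3 \<and> treewidth (toroidal_grid n n) = 2 * int n - 1)"
proof (intro conjI)
  have main: "(2 \<le> \<bar>int m - int n\<bar> \<longrightarrow> treewidth (toroidal_grid m n) = 2 * int (min m n)) \<and>
      (\<bar>int m - int n\<bar> = 1 \<longrightarrow> treewidth (toroidal_grid m n) = 2 * int (min m n) - 1 \<or>
        treewidth (toroidal_grid m n) = 2 * int (min m n)) \<and>
      (m = n \<longrightarrow> treewidth (toroidal_grid m n) = 2 * int n - 2 \<or> treewidth (toroidal_grid m n) = 2 * int n - 1)"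
    if "3 \<le> n" "n \<le> m" for m n
    using treewidth_toroidal_grid_bounds[OF that] treewidth_square_le[OF that(1)] that by auto
  show "\<forall>m n :: nat. m \<ge> 3 \<and> n \<ge> 3 \<longrightarrow>
        (\<bar>int m - int n\<bar> \<ge> 2 \<longrightarrow>
           treewidth (toroidal_grid m n) = 2 * int (min m n)) \<and>
        (\<bar>int m - int n\<bar> = 1 \<longrightarrow>
           treewidth (toroidal_grid m n) = 2 * int (min m n) - 1 \<or>
           treewidth (toroidal_grid m n) = 2 * int (min m n)) \<and>
        (m = n \<longrightarrow>
           treewidth (toroidal_grid m n) = 2 * int n - 2 \<or>
           treewidth (toroidal_grid m n) = 2 * int n - 1)"
  proof (intro allI impI)
    fix m n :: nat assume mn: "3 \<le> m \<and> 3 \<le> n"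
    show "(\<bar>int m - int n\<bar> \<ge> 2 \<longrightarrow> treewidth (toroidal_grid m n) = 2 * int (min m n)) \<and>
        (\<bar>int m - int n\<bar> = 1 \<longrightarrow> treewidth (toroidal_grid m n) = 2 * int (min m n) - 1 \<or>
           treewidth (toroidal_grid m n) = 2 * int (min m n)) \<and>
        (m = n \<longrightarrow> treewidth (toroidal_grid m n) = 2 * int n - 2 \<or>
           treewidth (toroidal_grid m n) = 2 * int n - 1)"
    proof (cases "n \<le> m")
      case True
      then show ?thesis using main[of n m] mn by blast
    next
      case False
      then have "m \<le> n" by simp
      then show ?thesis
        using main[of m n] mn
        unfolding treewidth_toroidal_grid_commute[of m n, OF conjunct1[OF mn] conjunct2[OF mn]]
          min.commute[of m n] abs_minus_commute[of "int m" "int n"]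
        by auto
    qed
  qed
  \<comment> \<open>The \<open>4 \<times> 3\<close> torus: the certificate of width 5 meets the
    general lower bound \<open>2 * 3 - 1\<close>.\<close>
  show "\<exists>m n :: nat. m \<ge> 3 \<and> n \<ge> 3 \<and> \<bar>int m - int n\<bar> = 1 \<and>
      treewidth (toroidal_grid m n) = 2 * int (min m n) - 1"
    using treewidth_toroidal_grid_4_3_le treewidth_toroidal_grid_bounds(3)[of 3 4]
    by (intro exI[of _ 4] exI[of _ 3]) simp
  show "\<exists>m n :: nat. m \<ge> 3 \<and> n \<ge> 3 \<and> \<bar>int m - int n\<bar> = 1 \<and>
      treewidth (toroidal_grid m n) = 2 * int (min m n)"
    using treewidth_toroidal_grid_5_4_ge treewidth_toroidal_grid_bounds(1)[of 4 5]
    by (intro exI[of _ 5] exI[of _ 4]) simp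
  \<comment> \<open>For \<open>n = 4\<close> the certificate of width 6 meets the general lower
    bound \<open>2 * 4 - 2\<close>.\<close>
  show "\<exists>n :: nat. n \<ge> 3 \<and> treewidth (toroidal_grid n n) = 2 * int n - 2"
    using treewidth_toroidal_grid_4_4_le treewidth_toroidal_grid_bounds(2)[of 4 4]
    by (intro exI[of _ 4]) simp
  show "\<exists>n :: nat. n \<ge> 3 \<and> treewidth (toroidal_grid n n) = 2 * int n - 1"
    using treewidth_toroidal_grid_3_3_ge treewidth_square_le[of 3]
    by (intro exI[of _ 3]) simp
qed

end
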